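(* Let $J$ be a one-sided Jacobi matrix with parameters $a_n>0$, $b_n\in\mathbb{R}$ ($n=1,2,\dots$) such that $$\sup_n(|a_n|+|b_n|)<\infty .$$ Let $\mathcal{R}$ be the set of right limit points of $J$, where the right limits $J^{(r)}$ are allowed to have some $a_n^{(r)}=0$. Then $$\overline{\bigcup_{r\in\mathcal{R}}\sigma(J^{(r)})}=\sigma_{\mathrm{ess}}(J).$$
   Context: The Jacobi matrix $J$ is the selfadjoint tridiagonal operator on $\ell^2(\{1,2,\dots\})$ with $J_{n,n}=b_n$, $J_{n,n+1}=J_{n+1,n}=a_n$. A right limit point of $J$ is a two-sided tridiagonal matrix $J^{(r)}$ on $\ell^2(\mathbb{Z})$ with parameters $\{a_n^{(r)},b_n^{(r)}\}_{n=-\infty}^\infty$, $a_n^{(r)}\ge0$, $b_n^{(r)}\in\mathbb{R}$ (same matrix form), for which there is a subsequence $n_j\to\infty$ such that, for each fixed $\ell=0,\pm1,\pm2,\dots$, $a_{n_j+\ell}\to a_\ell^{(r)}$ and $b_{n_j+\ell}\to b_\ell^{(r)}$ as $j\to\infty$. If $a^{(r)}_n=0$, then $J^{(r)}$ decouples as a direct sum on $\ell^2(-\infty,n]\oplus\ell^2[n+1,\infty)$. $\sigma,\sigma_{\mathrm{ess}}$ denote spectrum and essential spectrum. *)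

theory Defs
  imports "HOL-Analysis.Analysis"
begin

text \<open>
  The complex Hilbert space of square-summable families over an index set \<open>I\<close>. Its elements are
  functions on the whole index type, normalised to vanish outside \<open>I\<close>; hence equality in \<open>ell2 I\<close>
  is equality of functions.
\<close>

definition ell2 :: "'i set \<Rightarrow> ('i \<Rightarrow> complex) set" where
  "ell2 I = {u. (\<forall>i. i \<notin> I \<longrightarrow> u i = 0) \<and> (\<lambda>i. (cmod (u i))\<^sup>2) summable_on I}"

definition ell2_norm :: "'i set \<Rightarrow> ('i \<Rightarrow> complex) \<Rightarrow> real" where
  "ell2_norm I u = sqrt (\<Sum>\<^sub>\<infinity>i\<in>I. (cmod (u i))\<^sup>2)"

definition ell2_closed :: "'i set \<Rightarrow> ('i \<Rightarrow> complex) set \<Rightarrow> bool" where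
  "ell2_closed I S \<longleftrightarrow>
     (\<forall>s v. (\<forall>k::nat. s k \<in> S) \<and> v \<in> ell2 I \<and>
            (\<lambda>k. ell2_norm I (\<lambda>i. s k i - v i)) \<longlonglongrightarrow> 0 \<longrightarrow> v \<in> S)"

text \<open>
  In the following, an operator is a map \<open>T\<close> on functions that restricts to a bounded linear
  operator from \<open>ell2 I\<close> to itself; its values outside \<open>ell2 I\<close> are irrelevant.
\<close>

definition shift_op :: "(('i \<Rightarrow> complex) \<Rightarrow> 'i \<Rightarrow> complex) \<Rightarrow> complex \<Rightarrow> ('i \<Rightarrow> complex) \<Rightarrow> 'i \<Rightarrow> complex"
  where "shift_op T z u = (\<lambda>i. T u i - z * u i)"

definition boundedly_invertible :: "'i set \<Rightarrow> (('i \<Rightarrow> complex) \<Rightarrow> 'i \<Rightarrow> complex) \<Rightarrow> bool" where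
  "boundedly_invertible I T \<longleftrightarrow>
     bij_betw T (ell2 I) (ell2 I) \<and>
     (\<exists>C. \<forall>v\<in>ell2 I. ell2_norm I (inv_into (ell2 I) T v) \<le> C * ell2_norm I v)"

definition spectrum :: "'i set \<Rightarrow> (('i \<Rightarrow> complex) \<Rightarrow> 'i \<Rightarrow> complex) \<Rightarrow> complex set" where
  "spectrum I T = {z. \<not> boundedly_invertible I (shift_op T z)}"

text \<open>
  Fredholm operators: finite-dimensional kernel, closed range, range of finite codimension.
  The (at most) finite-dimensional complement of the range is spanned by the finite set \<open>B\<close>.
\<close>

definition fredholm :: "'i set \<Rightarrow> (('i \<Rightarrow> complex) \<Rightarrow> 'i \<Rightarrow> complex) \<Rightarrow> bool" where
  "fredholm I T \<longleftrightarrow>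
     (\<exists>B. finite B \<and> B \<subseteq> ell2 I \<and>
          (\<forall>u\<in>ell2 I. T u = (\<lambda>i. 0) \<longrightarrow> (\<exists>c. u = (\<lambda>i. \<Sum>w\<in>B. c w * w i)))) \<and>
     ell2_closed I (T ` ell2 I) \<and>
     (\<exists>B. finite B \<and> B \<subseteq> ell2 I \<and>
          (\<forall>v\<in>ell2 I. \<exists>u\<in>ell2 I. \<exists>c. v = (\<lambda>i. T u i + (\<Sum>w\<in>B. c w * w i))))"

text \<open>
  For selfadjoint operators this set coincides with the spectrum minus the isolated eigenvalues of
  finite multiplicity, so the usual definitions of the essential spectrum agree.
\<close>

definition ess_spectrum :: "'i set \<Rightarrow> (('i \<Rightarrow> complex) \<Rightarrow> 'i \<Rightarrow> complex) \<Rightarrow> complex set" where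
  "ess_spectrum I T = {z. \<not> fredholm I (shift_op T z)}"

definition jacobi_entry ::
    "('i::linordered_semidom \<Rightarrow> real) \<Rightarrow> ('i \<Rightarrow> real) \<Rightarrow> 'i \<Rightarrow> 'i \<Rightarrow> real" where
  "jacobi_entry a b m n =
     (if n = m then b m else if n = m + 1 then a m else if m = n + 1 then a n else 0)"

text \<open>
  The infinite sum has at most three nonzero terms. Both the half-line case (\<open>I = {1..}\<close> in the
  naturals, where \<open>a 0\<close> and \<open>b 0\<close> do not enter) and the whole-line case (\<open>I = UNIV\<close> in the
  integers) are instances.
\<close>

definition jacobi ::
    "'i::linordered_semidom set \<Rightarrow> ('i \<Rightarrow> real) \<Rightarrow> ('i \<Rightarrow> real) \<Rightarrow> ('i \<Rightarrow> complex) \<Rightarrow> 'i \<Rightarrow> complex"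
  where
  "jacobi I a b u =
     (\<lambda>m. if m \<in> I then \<Sum>\<^sub>\<infinity>n\<in>I. complex_of_real (jacobi_entry a b m n) * u n else 0)"

text \<open>
  Right limit points, represented by their parameters. For fixed \<open>l\<close> the truncation by \<open>nat\<close>, as
  well as an index \<open>0\<close>, affects only finitely many \<open>j\<close>.
\<close>

definition right_limits ::
    "(nat \<Rightarrow> real) \<Rightarrow> (nat \<Rightarrow> real) \<Rightarrow> ((int \<Rightarrow> real) \<times> (int \<Rightarrow> real)) set" where
  "right_limits a b =
     {(ar, br). (\<forall>l. ar l \<ge> 0) \<and>
        (\<exists>N::nat \<Rightarrow> nat. strict_mono N \<and>
           (\<forall>l. (\<lambda>j. a (nat (int (N j) + l))) \<longlonglongrightarrow> ar l \<and>
                (\<lambda>j. b (nat (int (N j) + l))) \<longlonglongrightarrow> br l))}"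

end

theory Submission imports Defs begin

text \<open>
  Call \<open>z\<close> a Weyl point of \<open>J\<close> if, for all \<open>e > 0\<close> and \<open>N\<close>, some finitely supported \<open>u \<noteq> 0\<close> living on
  \<open>[N, \<infinity>)\<close> satisfies \<open>norm ((J - z) u) < e * norm u\<close>. The Weyl points form a closed set, and they are
  exactly the essential spectrum: at a Weyl point the range of \<open>J - z\<close> is not closed, whereas at any
  other point the norm of \<open>u\<close> is controlled by \<open>(J - z) u\<close> and finitely many entries of \<open>u\<close>.

  Translating a truncated approximate eigenvector of a right limit far to the right along \<open>J\<close> shows
  that spectra of right limits consist of Weyl points. Conversely, far out approximate eigenvectors
  of \<open>J\<close> can be cut down to windows of a fixed length \<open>L\<close> at the price of an error \<open>O(1 / L)\<close> in
  the squared norm. By compactness the windows converge, together with the surrounding coefficients,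
  to an approximate eigenvector of a right limit, whose spectrum therefore comes close to \<open>z\<close>.
\<close>

subsection \<open>The Hilbert space of square-summable families\<close>

text \<open>Spectral measures never enter: every spectral statement is turned into lower bounds for
  \<open>norm (shifted z u)\<close>, and surjectivity comes from a contraction argument. The spaces
  are treated as real Hilbert spaces, with the real part of the hermitian product as inner product;
  complex scalars act through \<open>cscale\<close>, whose adjoint is multiplication by the
  conjugate.

  Operators act on families over the whole index type. The half-line matrix therefore carries a
  spurious coordinate 0, on which \<open>J - z\<close> is multiplication by \<open>- z\<close>;
  hence the recurring condition \<open>coord u 0 = 0\<close>.

  At a Weyl point the kernel cannot be what destroys the Fredholm property: all \<open>a n\<close>
  are positive, so a solution of \<open>(J - z) u = 0\<close> is determined by its first entry. The
  obstruction is therefore sought in the range. Right limits may have vanishing off-diagonal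
  entries, for which this recursion breaks down; on the line only lower bounds are used.\<close>

lemma ell2_UNIV_iff: "u \<in> ell2 UNIV \<longleftrightarrow> (\<lambda>i. (cmod (u i))\<^sup>2) summable_on UNIV"
  by (simp add: ell2_def)

lemma sq_add_le: "(cmod (x + y))\<^sup>2 \<le> 2 * (cmod x)\<^sup>2 + 2 * (cmod y)\<^sup>2"
proof -
  have "(cmod (x + y))\<^sup>2 \<le> (cmod x + cmod y)\<^sup>2"
    by (simp add: norm_triangle_ineq power_mono)
  also have "\<dots> \<le> 2 * (cmod x)\<^sup>2 + 2 * (cmod y)\<^sup>2"
    using zero_le_power2[of "cmod x - cmod y"] by (simp add: power2_eq_square algebra_simps)
  finally show ?thesis .
qed

lemma ell2_UNIV_I:
  assumes "\<And>F. finite F \<Longrightarrow> (\<Sum>i\<in>F. (cmod (u i))\<^sup>2) \<le> C"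
  shows "u \<in> ell2 UNIV"
  unfolding ell2_UNIV_iff
  by (rule nonneg_bdd_above_summable_on) (use assms in \<open>auto intro!: bdd_aboveI\<close>)

lemma ell2_zero: "(\<lambda>_. 0) \<in> ell2 UNIV"
  by (simp add: ell2_UNIV_iff)

lemma ell2_add:
  assumes "u \<in> ell2 UNIV" "v \<in> ell2 UNIV"
  shows "(\<lambda>i. u i + v i) \<in> ell2 UNIV"
  unfolding ell2_UNIV_iff
proof (rule summable_on_comparison_test)
  show "(\<lambda>i. 2 * (cmod (u i))\<^sup>2 + 2 * (cmod (v i))\<^sup>2) summable_on UNIV"
    using assms by (intro summable_on_add summable_on_cmult_right) (auto simp: ell2_UNIV_iff)
qed (auto intro: sq_add_le)

lemma ell2_mult_bounded:
  assumes "u \<in> ell2 UNIV" "\<And>i. cmod (w i) \<le> M"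
  shows "(\<lambda>i. w i * u i) \<in> ell2 UNIV"
  unfolding ell2_UNIV_iff
proof (rule summable_on_comparison_test)
  show "(\<lambda>i. M\<^sup>2 * (cmod (u i))\<^sup>2) summable_on UNIV"
    using assms by (intro summable_on_cmult_right) (auto simp: ell2_UNIV_iff)
  show "(cmod (w i * u i))\<^sup>2 \<le> M\<^sup>2 * (cmod (u i))\<^sup>2" for i
    using assms(2)[of i] by (auto simp: norm_mult power_mult_distrib intro!: mult_right_mono power_mono)
qed auto

lemma ell2_inner_summable:
  assumes "u \<in> ell2 UNIV" "v \<in> ell2 UNIV"
  shows "(\<lambda>i. u i \<bullet> v i) summable_on UNIV"
proof (rule abs_summable_summable, rule summable_on_comparison_test)
  show "(\<lambda>i. (cmod (u i))\<^sup>2 + (cmod (v i))\<^sup>2) summable_on UNIV"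
    using assms by (intro summable_on_add) (auto simp: ell2_UNIV_iff)
  show "norm (u i \<bullet> v i) \<le> (cmod (u i))\<^sup>2 + (cmod (v i))\<^sup>2" for i
  proof -
    have "norm (u i \<bullet> v i) \<le> cmod (u i) * cmod (v i)"
      by (simp add: Cauchy_Schwarz_ineq2)
    also have "\<dots> \<le> (cmod (u i))\<^sup>2 + (cmod (v i))\<^sup>2"
      using sum_squares_bound[of "cmod (u i)" "cmod (v i)"]
        mult_nonneg_nonneg[OF norm_ge_zero norm_ge_zero, of "u i" "v i"]
      unfolding mult.assoc by linarith
    finally show ?thesis .
  qed
qed auto

text \<open>A type of its own makes the class machinery for Hilbert spaces, series and bounded
  linear maps available. For smaller index sets, \<open>ell2 I\<close> is recovered as the vectors
  vanishing off \<open>I\<close>.\<close>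

typedef 'i l2 = "ell2 (UNIV :: 'i set)" morphisms coord Abs_l2
  using ell2_zero by blast

setup_lifting type_definition_l2

lemma coord_inverse_ell2 [simp]: "u \<in> ell2 UNIV \<Longrightarrow> coord (Abs_l2 u) = u"
  by (rule Abs_l2_inverse)

lemma coord_summable: "(\<lambda>i. (cmod (coord u i))\<^sup>2) summable_on UNIV"
  using coord[of u] by (simp add: ell2_UNIV_iff)

lemma l2_eqI: "(\<And>i. coord u i = coord v i) \<Longrightarrow> u = v"
  by (metis coord_inject ext)

instantiation l2 :: (type) real_vector
begin

lift_definition zero_l2 :: "'a l2" is "\<lambda>_. 0" by (rule ell2_zero)

lift_definition plus_l2 :: "'a l2 \<Rightarrow> 'a l2 \<Rightarrow> 'a l2" is "\<lambda>u v i. u i + v i"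
  by (rule ell2_add)

lift_definition uminus_l2 :: "'a l2 \<Rightarrow> 'a l2" is "\<lambda>u i. - u i"
  by (simp add: ell2_UNIV_iff)

lift_definition minus_l2 :: "'a l2 \<Rightarrow> 'a l2 \<Rightarrow> 'a l2" is "\<lambda>u v i. u i - v i"
proof -
  fix u v :: "'a \<Rightarrow> complex"
  assume "u \<in> ell2 UNIV" "v \<in> ell2 UNIV"
  then show "(\<lambda>i. u i - v i) \<in> ell2 UNIV"
    using ell2_add[of u "\<lambda>i. - v i"] by (simp add: ell2_UNIV_iff)
qed

lift_definition scaleR_l2 :: "real \<Rightarrow> 'a l2 \<Rightarrow> 'a l2" is "\<lambda>r u i. r *\<^sub>R u i"
  using ell2_mult_bounded[of _ "\<lambda>_. complex_of_real _"] by (auto simp: scaleR_conv_of_real)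

instance
  by standard (transfer; simp add: algebra_simps)+

end

instantiation l2 :: (type) real_inner
begin

definition inner_l2 :: "'a l2 \<Rightarrow> 'a l2 \<Rightarrow> real" where
  "inner_l2 u v = (\<Sum>\<^sub>\<infinity>i. coord u i \<bullet> coord v i)"

definition norm_l2 :: "'a l2 \<Rightarrow> real" where "norm_l2 u = sqrt (u \<bullet> u)"
definition dist_l2 :: "'a l2 \<Rightarrow> 'a l2 \<Rightarrow> real" where "dist_l2 u v = norm (u - v)"
definition sgn_l2 :: "'a l2 \<Rightarrow> 'a l2" where "sgn_l2 u = u /\<^sub>R norm u"
definition uniformity_l2 :: "('a l2 \<times> 'a l2) filter" where
  "uniformity_l2 = (INF e\<in>{0<..}. principal {(x, y). dist x y < e})"
definition open_l2 :: "'a l2 set \<Rightarrow> bool" where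
  "open_l2 U \<longleftrightarrow> (\<forall>x\<in>U. eventually (\<lambda>(x', y). x' = x \<longrightarrow> y \<in> U) uniformity)"

instance
proof
  fix u v w :: "'a l2" and r :: real
  have s: "(\<lambda>i. coord u i \<bullet> coord v i) summable_on UNIV" for u v :: "'a l2"
    using coord ell2_inner_summable by blast
  show "dist u v = norm (u - v)" "sgn u = u /\<^sub>R norm u"
    "uniformity = (INF e\<in>{0<..}. principal {(x::'a l2, y). dist x y < e})"
    "norm u = sqrt (u \<bullet> u)"
    by (simp_all add: dist_l2_def sgn_l2_def uniformity_l2_def norm_l2_def)
  show "open U \<longleftrightarrow> (\<forall>x\<in>U. eventually (\<lambda>(x', y). x' = x \<longrightarrow> y \<in> U) uniformity)" for U :: "'a l2 set"
    by (simp add: open_l2_def)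
  show "u \<bullet> v = v \<bullet> u"
    by (simp add: inner_l2_def inner_commute)
  show "(u + v) \<bullet> w = u \<bullet> w + v \<bullet> w"
    by (simp add: inner_l2_def plus_l2.rep_eq inner_add_left infsum_add s)
  show "r *\<^sub>R u \<bullet> v = r * (u \<bullet> v)"
    by (simp add: inner_l2_def scaleR_l2.rep_eq infsum_cmult_right')
  show "0 \<le> u \<bullet> u"
    by (simp add: inner_l2_def infsum_nonneg)
  show "u \<bullet> u = 0 \<longleftrightarrow> u = 0"
  proof
    assume "u \<bullet> u = 0"
    then have "coord u i \<bullet> coord u i = 0" for i
      using nonneg_infsum_le_0D[of "\<lambda>i. coord u i \<bullet> coord u i" UNIV i] s
      by (simp add: inner_l2_def)
    then show "u = 0"
      by (intro l2_eqI) (simp add: zero_l2.rep_eq)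
  qed (simp add: inner_l2_def zero_l2.rep_eq)
qed

end

lemmas coord_simps [simp] =
  zero_l2.rep_eq plus_l2.rep_eq minus_l2.rep_eq uminus_l2.rep_eq scaleR_l2.rep_eq

lemma norm_l2_sq: "(norm u)\<^sup>2 = (\<Sum>\<^sub>\<infinity>i. (cmod (coord u i))\<^sup>2)"
  by (simp add: power2_norm_eq_inner inner_l2_def)

lemma sum_le_norm_l2_sq: "finite F \<Longrightarrow> (\<Sum>i\<in>F. (cmod (coord u i))\<^sup>2) \<le> (norm u)\<^sup>2"
  unfolding norm_l2_sq by (rule finite_sum_le_infsum) (auto simp: coord_summable)

lemma norm_l2_sq_leI:
  assumes "\<And>F. finite F \<Longrightarrow> (\<Sum>i\<in>F. (cmod (coord u i))\<^sup>2) \<le> C"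
  shows "(norm u)\<^sup>2 \<le> C"
  unfolding norm_l2_sq by (rule infsum_le_finite_sums) (use assms coord_summable in auto)

lemma norm_l2_sq_finite:
  assumes "finite F" "\<And>i. i \<notin> F \<Longrightarrow> coord u i = 0"
  shows "(norm u)\<^sup>2 = (\<Sum>i\<in>F. (cmod (coord u i))\<^sup>2)"
  unfolding norm_l2_sq
  using assms by (subst infsum_cong_neutral[of F UNIV]) auto

lemma cmod_coord_le: "cmod (coord u i) \<le> norm u"
  using sum_le_norm_l2_sq[of "{i}" u] by simp

lemma bounded_linear_coord: "bounded_linear (\<lambda>u. coord u i)"
  by (rule bounded_linear_intro[where K = 1]) (auto simp: cmod_coord_le)

lemma coord_sum: "coord (\<Sum>k\<in>K. f k) i = (\<Sum>k\<in>K. coord (f k) i)"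
  using bounded_linear.linear[OF bounded_linear_coord] by (rule linear_sum)

lemmas tendsto_coord = bounded_linear.tendsto[OF bounded_linear_coord]

instance l2 :: (type) complete_space
proof
  fix X :: "nat \<Rightarrow> 'a l2"
  assume X: "Cauchy X"
  have "\<exists>x. (\<lambda>n. coord (X n) i) \<longlonglongrightarrow> x" for i
    using bounded_linear.Cauchy[OF bounded_linear_coord X] by (simp add: Cauchy_convergent_iff convergent_def)
  then obtain x where x: "\<And>i. (\<lambda>n. coord (X n) i) \<longlonglongrightarrow> x i"
    by metis
  \<comment> \<open>A Fatou argument: a bound on finite partial sums survives the entrywise limit in
    \<open>n\<close>.\<close>
  have bound: "(\<Sum>i\<in>F. (cmod (coord (X m) i - x i))\<^sup>2) \<le> e\<^sup>2"
    if F: "finite F" and e: "\<And>n. n \<ge> m \<Longrightarrow> norm (X m - X n) \<le> e" for F m e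
  proof (rule tendsto_upperbound)
    show "(\<lambda>n. \<Sum>i\<in>F. (cmod (coord (X m) i - coord (X n) i))\<^sup>2)
      \<longlonglongrightarrow> (\<Sum>i\<in>F. (cmod (coord (X m) i - x i))\<^sup>2)"
      by (intro tendsto_intros x)
    show "\<forall>\<^sub>F n in sequentially. (\<Sum>i\<in>F. (cmod (coord (X m) i - coord (X n) i))\<^sup>2) \<le> e\<^sup>2"
      using eventually_ge_at_top[of m]
    proof eventually_elim
      case (elim n)
      have "(\<Sum>i\<in>F. (cmod (coord (X m) i - coord (X n) i))\<^sup>2) \<le> (norm (X m - X n))\<^sup>2"
        using sum_le_norm_l2_sq[OF F, of "X m - X n"] by simp
      also have "\<dots> \<le> e\<^sup>2"
        using e[OF elim] by (intro power_mono) auto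
      finally show ?case .
    qed
  qed auto
  have small: "\<exists>m. \<forall>k\<ge>m. \<forall>n\<ge>m. norm (X k - X n) < e" if "e > 0" for e
    using X that by (auto simp: Cauchy_def dist_norm)
  obtain m where "\<And>k n. k \<ge> m \<Longrightarrow> n \<ge> m \<Longrightarrow> norm (X k - X n) < 1"
    using small[of 1] by auto
  then have "(\<lambda>i. coord (X m) i - x i) \<in> ell2 UNIV"
    by (intro ell2_UNIV_I[where C = "1\<^sup>2"] bound) (auto intro: less_imp_le)
  \<comment> \<open>\<open>x\<close> is written as \<open>X m - (X m - x)\<close>, a difference of
    two square-summable families.\<close>
  then have "(\<lambda>i. coord (X m) i + (- 1) * (coord (X m) i - x i)) \<in> ell2 UNIV"
    by (intro ell2_add ell2_mult_bounded[where M = 1] coord) auto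
  then have x_ell2: "x \<in> ell2 UNIV"
    by simp
  have "X \<longlonglongrightarrow> Abs_l2 x"
  proof (rule LIMSEQ_I)
    fix e :: real
    assume "e > 0"
    then obtain m where m: "\<And>k n. k \<ge> m \<Longrightarrow> n \<ge> m \<Longrightarrow> norm (X k - X n) < e / 2"
      using small[of "e / 2"] by auto
    have "norm (X k - Abs_l2 x) < e" if "k \<ge> m" for k
    proof -
      have le: "norm (X k - X n) \<le> e / 2" if "n \<ge> k" for n
        using m[of k n] that \<open>k \<ge> m\<close> by simp
      have "(\<Sum>i\<in>F. (cmod (coord (X k) i - x i))\<^sup>2) \<le> (e / 2)\<^sup>2" if "finite F" for F
        by (rule bound[OF that le])
      then have "(norm (X k - Abs_l2 x))\<^sup>2 \<le> (e / 2)\<^sup>2"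
        using x_ell2 by (intro norm_l2_sq_leI) simp
      then have "norm (X k - Abs_l2 x) \<le> e / 2"
        by (rule power2_le_imp_le) (use \<open>e > 0\<close> in auto)
      with \<open>e > 0\<close> show ?thesis by simp
    qed
    then show "\<exists>m. \<forall>k\<ge>m. norm (X k - Abs_l2 x) < e" by blast
  qed
  then show "convergent X" by (auto simp: convergent_def)
qed

instance l2 :: (type) banach ..

subsection \<open>Coercive, normal and symmetric operators on real Hilbert spaces\<close>

text \<open>The Lax-Milgram theorem: for small \<open>t\<close> the map
  \<open>u - t (P u - v)\<close> is a contraction, and its fixed point solves
  \<open>P u = v\<close>.\<close>

lemma coercive_surj:
  fixes P :: "'a::{real_inner,complete_space} \<Rightarrow> 'a"
  assumes P: "bounded_linear P" and c: "c > 0" and coercive: "\<And>u. c * (norm u)\<^sup>2 \<le> P u \<bullet> u"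
  shows "surj P"
  unfolding surj_def
proof
  fix v
  interpret P: bounded_linear P by (rule P)
  obtain K0 where K0: "K0 > 0" "\<And>u. norm (P u) \<le> norm u * K0"
    using P.pos_bounded by blast
  \<comment> \<open>Taking \<open>K\<close> at least \<open>c\<close> makes
    \<open>1 - c\<^sup>2 / K\<^sup>2\<close> nonnegative, so that its root \<open>q\<close> can
    serve as contraction factor.\<close>
  define K where "K = max K0 c"
  have K: "K > 0" "c \<le> K" "norm (P u) \<le> norm u * K" for u
    using K0(1) order_trans[OF K0(2)[of u] mult_left_mono, of K] by (auto simp: K_def)
  \<comment> \<open>This \<open>t\<close> minimises the contraction bound
    \<open>1 - 2 * t * c + t\<^sup>2 * K\<^sup>2\<close>.\<close>
  define t where "t = c / K\<^sup>2"
  have t: "t > 0" using c K by (simp add: t_def)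
  define q where "q = sqrt (1 - c\<^sup>2 / K\<^sup>2)"
  have ck: "0 < c\<^sup>2 / K\<^sup>2" "c\<^sup>2 / K\<^sup>2 \<le> 1"
    using c K(1,2) by (auto simp: divide_le_eq power_mono)
  have q: "0 \<le> q" "q < 1" "q\<^sup>2 = 1 - c\<^sup>2 / K\<^sup>2"
    using ck by (auto simp: q_def)
  define f where "f u = u - t *\<^sub>R (P u - v)" for u
  have "dist (f u) (f w) \<le> q * dist u w" for u w
  proof -
    define d where "d = u - w"
    have f_diff: "f u - f w = d - t *\<^sub>R P d"
      by (simp add: f_def d_def P.diff algebra_simps)
    have "(norm (f u - f w))\<^sup>2 = (norm d)\<^sup>2 - 2 * t * (P d \<bullet> d) + t\<^sup>2 * (norm (P d))\<^sup>2"
      unfolding f_diff power2_norm_eq_inner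
      by (simp add: inner_diff_left inner_diff_right inner_commute power2_eq_square)
    also have "\<dots> \<le> (norm d)\<^sup>2 - 2 * t * (c * (norm d)\<^sup>2) + t\<^sup>2 * (norm d * K)\<^sup>2"
      using coercive[of d] t K(3)[of d] by (intro add_mono diff_mono mult_left_mono power_mono) auto
    also have "\<dots> = (norm d)\<^sup>2 * (1 - 2 * (t * c) + t\<^sup>2 * K\<^sup>2)"
      by (simp add: algebra_simps power_mult_distrib)
    also have "t * c = c\<^sup>2 / K\<^sup>2" by (simp add: t_def power2_eq_square)
    also have "t\<^sup>2 * K\<^sup>2 = c\<^sup>2 / K\<^sup>2" using K(1) by (simp add: t_def power2_eq_square)
    also have "(norm d)\<^sup>2 * (1 - 2 * (c\<^sup>2 / K\<^sup>2) + c\<^sup>2 / K\<^sup>2) = (q * norm d)\<^sup>2"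
      by (simp add: q power_mult_distrib)
    finally have "norm (f u - f w) \<le> q * norm d"
      by (rule power2_le_imp_le) (use q in auto)
    then show ?thesis by (simp add: dist_norm d_def)
  qed
  then obtain u where "f u = u"
    using banach_fix_type[OF q(1,2), of f] by blast
  then have "v = P u"
    using t by (simp add: f_def)
  then show "\<exists>u. v = P u" by blast
qed

locale normal_op =
  fixes S S' :: "'a::{real_inner,complete_space} \<Rightarrow> 'a"
  assumes bounded: "bounded_linear S" "bounded_linear S'"
    and adjoint: "S u \<bullet> v = u \<bullet> S' v"
    and commute: "S (S' u) = S' (S u)"
begin

lemma norm_adjoint_eq: "norm (S' u) = norm (S u)"
proof -
  have "S' u \<bullet> S' u = S u \<bullet> S u"
    using adjoint[of "S' u" u] adjoint[of u "S u"] commute[of u] by (simp add: inner_commute)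
  then show ?thesis by (simp add: norm_eq_sqrt_inner)
qed

text \<open>Normality transfers the lower bound to the adjoint, so \<open>S S'\<close> is coercive
  and hence onto; the range of \<open>S\<close> contains that of \<open>S S'\<close>.\<close>

lemma bij_if_bounded_below:
  assumes c: "c > 0" "\<And>u. c * norm u \<le> norm (S u)"
  shows "bij S"
proof (rule bijI)
  interpret S: bounded_linear S by (rule bounded)
  show "inj S"
  proof (rule injI)
    fix x y assume "S x = S y"
    then have "c * norm (x - y) \<le> 0"
      using c(2)[of "x - y"] by (simp add: S.diff)
    then show "x = y" using c(1) by (simp add: mult_le_0_iff)
  qed
  have "surj (\<lambda>u. S (S' u))"
  proof (rule coercive_surj)
    show "bounded_linear (\<lambda>u. S (S' u))"
      using bounded by (rule bounded_linear_compose)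
    show "c\<^sup>2 > 0" using c by simp
    show "c\<^sup>2 * (norm u)\<^sup>2 \<le> S (S' u) \<bullet> u" for u
    proof -
      have "(c * norm u)\<^sup>2 \<le> (norm (S' u))\<^sup>2"
        using c(1) c(2)[of u] by (intro power_mono) (auto simp: norm_adjoint_eq)
      then show ?thesis
        by (simp add: power_mult_distrib adjoint power2_norm_eq_inner)
    qed
  qed
  then show "surj S" unfolding surj_def by blast
qed

end

text \<open>
  The infimum \<open>m\<close> of \<open>norm (B u) / norm u\<close> satisfies: \<open>B - m\<close> or \<open>B + m\<close> is not bounded below.
  Otherwise their product \<open>P = B\<^sup>2 - m\<^sup>2\<close> is bounded below, and, \<open>P\<close> being positive semidefinite,
  \<open>norm (P u)\<^sup>2 \<le> K * (P u \<bullet> u)\<close>; then \<open>norm (B u)\<^sup>2 = P u \<bullet> u + m\<^sup>2 * norm u\<^sup>2\<close> exceeds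
  \<open>m\<^sup>2 * norm u\<^sup>2\<close> by a fixed multiple of \<open>norm u\<^sup>2\<close>.
\<close>

lemma symmetric_near_spectrum:
  fixes B :: "'a::real_inner \<Rightarrow> 'a"
  assumes B: "bounded_linear B" and sym: "\<And>u v. B u \<bullet> v = u \<bullet> B v"
    and v: "v \<noteq> 0" "norm (B v) \<le> e * norm v"
  obtains l :: real where "\<bar>l\<bar> \<le> e" "\<nexists>c. c > 0 \<and> (\<forall>u. c * norm u \<le> norm (B u - l *\<^sub>R u))"
proof -
  interpret B: bounded_linear B by (rule B)
  define m where "m = (INF u\<in>-{0}. norm (B u) / norm u)"
  have bdd: "bdd_below ((\<lambda>u. norm (B u) / norm u) ` (-{0}))"
    by (intro bdd_belowI[of _ 0]) auto
  have m_le: "m \<le> norm (B u) / norm u" if "u \<noteq> 0" for u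
    unfolding m_def using that by (intro cINF_lower bdd) auto
  have m_mult: "m * norm u \<le> norm (B u)" for u
    using m_le[of u] by (cases "u = 0") (auto simp: field_simps)
  have "m \<ge> 0"
    unfolding m_def using v(1) by (intro cINF_greatest) auto
  have "m \<le> e"
    using m_le[OF v(1)] v by (simp add: field_simps) (meson mult_right_le_imp_le order_trans zero_less_norm_iff)
  have "\<exists>l\<in>{m, - m}. \<nexists>c. c > 0 \<and> (\<forall>u. c * norm u \<le> norm (B u - l *\<^sub>R u))"
  proof (rule ccontr)
    assume "\<not> ?thesis"
    then obtain c1 c2 where c: "c1 > 0" "c2 > 0"
      and c1: "\<And>u. c1 * norm u \<le> norm (B u - m *\<^sub>R u)"
      and c2: "\<And>u. c2 * norm u \<le> norm (B u + m *\<^sub>R u)"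
      by auto
    define P where "P u = B (B u) - m\<^sup>2 *\<^sub>R u" for u
    have P: "bounded_linear P"
      unfolding P_def
      by (intro bounded_linear_sub bounded_linear_compose[OF B B] bounded_linear_scaleR_right)
    interpret P: bounded_linear P by (rule P)
    obtain K where K: "K > 0" "\<And>u. norm (P u) \<le> norm u * K"
      using P.pos_bounded by blast
    have P_form: "P u \<bullet> u = (norm (B u))\<^sup>2 - m\<^sup>2 * (norm u)\<^sup>2" for u
      by (simp add: P_def inner_diff_left sym[of "B u"] power2_norm_eq_inner)
    have P_sym: "P u \<bullet> w = u \<bullet> P w" for u w
      by (simp add: P_def inner_diff_left inner_diff_right sym)
    have P_nonneg: "P u \<bullet> u \<ge> 0" for u
      using power_mono[OF m_mult[of u], of 2] \<open>m \<ge> 0\<close> by (simp add: P_form power_mult_distrib)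
    have P_sq: "(norm (P u))\<^sup>2 / K \<le> P u \<bullet> u" for u
    proof -
      define w where "w = P u"
      have "P w \<bullet> w \<le> norm (P w) * norm w" by (rule norm_cauchy_schwarz)
      also have "\<dots> \<le> norm w * K * norm w" using K by (intro mult_right_mono) auto
      finally have "P w \<bullet> w \<le> K * (norm w)\<^sup>2" by (simp add: power2_eq_square mult_ac)
      then have "(1 / K)\<^sup>2 * (P w \<bullet> w) \<le> (1 / K)\<^sup>2 * (K * (norm w)\<^sup>2)"
        by (intro mult_left_mono) auto
      also have "\<dots> = (norm w)\<^sup>2 / K" using K(1) by (simp add: power2_eq_square)
      finally have 1: "(1 / K)\<^sup>2 * (P w \<bullet> w) \<le> (norm w)\<^sup>2 / K" .
      \<comment> \<open>Positivity is tested at \<open>u - P u / K\<close>. The cross term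
        contributes \<open>- 2 * (norm w)\<^sup>2 / K\<close>, and the last term gives back at most
        half of it.\<close>
      have "0 \<le> P (u - (1 / K) *\<^sub>R w) \<bullet> (u - (1 / K) *\<^sub>R w)" by (rule P_nonneg)
      also have "\<dots> = P u \<bullet> u - 2 * ((norm w)\<^sup>2 / K) + (1 / K)\<^sup>2 * (P w \<bullet> w)"
        unfolding P.diff P.scaleR inner_diff_left inner_diff_right inner_scaleR_left inner_scaleR_right
        by (simp add: P_sym[of w u] w_def[symmetric] dot_square_norm power2_eq_square algebra_simps)
      finally show ?thesis using 1 by (simp add: w_def)
    qed
    have P_below: "c1 * c2 * norm u \<le> norm (P u)" for u
    proof -
      have "P u = B (B u + m *\<^sub>R u) - m *\<^sub>R (B u + m *\<^sub>R u)"
        by (simp add: P_def B.add B.scaleR algebra_simps power2_eq_square)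
      then have "c1 * norm (B u + m *\<^sub>R u) \<le> norm (P u)"
        using c1 by simp
      moreover have "c1 * (c2 * norm u) \<le> c1 * norm (B u + m *\<^sub>R u)"
        using c c2 by (intro mult_left_mono) auto
      ultimately show ?thesis by (simp add: mult_ac)
    qed
    define d where "d = (c1 * c2)\<^sup>2 / K"
    have d: "d > 0" using c K by (simp add: d_def)
    have "sqrt (m\<^sup>2 + d) \<le> norm (B u) / norm u" if "u \<noteq> 0" for u
    proof -
      have "d * (norm u)\<^sup>2 = (c1 * c2 * norm u)\<^sup>2 / K"
        by (simp add: d_def power_mult_distrib)
      also have "\<dots> \<le> (norm (P u))\<^sup>2 / K"
        using P_below[of u] c K by (intro divide_right_mono power_mono) auto
      also have "\<dots> \<le> (norm (B u))\<^sup>2 - m\<^sup>2 * (norm u)\<^sup>2"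
        using P_sq[of u] by (simp add: P_form)
      finally have "(m\<^sup>2 + d) * (norm u)\<^sup>2 \<le> (norm (B u))\<^sup>2"
        by (simp add: algebra_simps)
      then have "sqrt ((m\<^sup>2 + d) * (norm u)\<^sup>2) \<le> norm (B u)"
        using real_sqrt_le_mono by fastforce
      then have "sqrt (m\<^sup>2 + d) * norm u \<le> norm (B u)"
        unfolding real_sqrt_mult by simp
      then show ?thesis using that by (simp add: pos_le_divide_eq)
    qed
    then have "sqrt (m\<^sup>2 + d) \<le> m"
      unfolding m_def[symmetric]
      by (subst (2) m_def) (intro cINF_greatest; use v(1) in auto)
    moreover have "m < sqrt (m\<^sup>2 + d)"
      using d \<open>m \<ge> 0\<close> by (intro real_less_rsqrt) auto
    ultimately show False by simp
  qed
  then show thesis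
    using that[of m] that[of "- m"] \<open>m \<le> e\<close> \<open>m \<ge> 0\<close> by auto
qed

subsection \<open>Multiplication, truncation and spectra on the sequence space\<close>

lift_definition cscale :: "complex \<Rightarrow> 'i l2 \<Rightarrow> 'i l2" is "\<lambda>z u i. z * u i"
  using ell2_mult_bounded[of _ "\<lambda>_. _"] by blast

lift_definition trunc :: "'i set \<Rightarrow> 'i l2 \<Rightarrow> 'i l2" is "\<lambda>F u i. if i \<in> F then u i else 0"
proof -
  fix F and u :: "'i \<Rightarrow> complex"
  assume "u \<in> ell2 UNIV"
  then have "(\<lambda>i. (if i \<in> F then 1 else 0) * u i) \<in> ell2 UNIV"
    by (rule ell2_mult_bounded[where M = 1]) auto
  then show "(\<lambda>i. if i \<in> F then u i else 0) \<in> ell2 UNIV"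
    by (simp add: if_distrib[of "\<lambda>x. x * _"] cong: if_cong)
qed

lemmas coord_cscale [simp] = cscale.rep_eq
lemmas coord_trunc = trunc.rep_eq

lemma norm_cscale [simp]: "norm (cscale z u) = cmod z * norm u"
proof -
  have "(norm (cscale z u))\<^sup>2 = (cmod z * norm u)\<^sup>2"
    by (simp add: norm_l2_sq norm_mult power_mult_distrib infsum_cmult_right')
  then show ?thesis by simp
qed

lemma inner_cscale: "cscale z u \<bullet> v = u \<bullet> cscale (cnj z) v"
  by (simp add: inner_l2_def inner_complex_def algebra_simps)

lemma bounded_linear_cscale: "bounded_linear (cscale z)"
  by (rule bounded_linear_intro[where K = "cmod z"])
    (auto intro!: l2_eqI simp: algebra_simps)

lemma cscale_commute: "cscale z (cscale w u) = cscale w (cscale z u)"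
  by (rule l2_eqI) simp

lemma inner_trunc: "trunc F u \<bullet> v = u \<bullet> trunc F v"
  unfolding inner_l2_def by (intro infsum_cong) (auto simp: coord_trunc)

lemma trunc_trunc [simp]: "trunc F (trunc F u) = trunc F u"
  by (rule l2_eqI) (simp add: coord_trunc)

lemma norm_trunc_sq: "(norm (trunc F u))\<^sup>2 = u \<bullet> trunc F u"
  by (simp add: power2_norm_eq_inner inner_trunc)

lemma trunc_compl: "u = trunc F u + trunc (- F) u"
  by (rule l2_eqI) (simp add: coord_trunc)

lemma norm_trunc_le: "norm (trunc F u) \<le> norm u"
proof -
  have "norm (trunc F u) * norm (trunc F u) \<le> norm u * norm (trunc F u)"
    using norm_cauchy_schwarz[of u "trunc F u"] by (simp add: norm_trunc_sq power2_eq_square flip: norm_trunc_sq)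
  then show ?thesis by (cases "norm (trunc F u) = 0") (auto simp: mult_le_cancel_right)
qed

lemma bounded_linear_trunc: "bounded_linear (trunc F)"
  by (rule bounded_linear_intro[where K = 1])
    (auto intro!: l2_eqI simp: norm_trunc_le coord_trunc)

text \<open>By Pythagoras the squared error is the remainder of the convergent sum of
  squares.\<close>

lemma tendsto_trunc: "((\<lambda>F. trunc F u) \<longlongrightarrow> u) (finite_subsets_at_top UNIV)"
proof -
  have "((\<lambda>F. (norm u)\<^sup>2 - (\<Sum>i\<in>F. (cmod (coord u i))\<^sup>2)) \<longlongrightarrow> (norm u)\<^sup>2 - (norm u)\<^sup>2)
      (finite_subsets_at_top UNIV)"
    using infsum_tendsto[OF coord_summable[of u]]
    by (intro tendsto_intros) (simp add: norm_l2_sq)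
  moreover have "(norm u)\<^sup>2 - (\<Sum>i\<in>F. (cmod (coord u i))\<^sup>2) = (norm (trunc F u - u))\<^sup>2"
    if "finite F" for F
  proof -
    have "(\<Sum>i\<in>F. (cmod (coord u i))\<^sup>2) = (norm (trunc F u))\<^sup>2"
      using norm_l2_sq_finite[OF that, of "trunc F u"] by (simp add: coord_trunc)
    then show ?thesis
      unfolding power2_norm_eq_inner
      by (simp add: inner_diff_left inner_diff_right inner_commute inner_trunc)
  qed
  then have "\<forall>\<^sub>F F in finite_subsets_at_top UNIV.
      (norm u)\<^sup>2 - (\<Sum>i\<in>F. (cmod (coord u i))\<^sup>2) = (norm (trunc F u - u))\<^sup>2"
    by (intro eventually_finite_subsets_at_top_weakI)
  ultimately have "((\<lambda>F. (norm (trunc F u - u))\<^sup>2) \<longlongrightarrow> 0) (finite_subsets_at_top UNIV)"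
    by (simp add: tendsto_cong)
  then have "((\<lambda>F. sqrt ((norm (trunc F u - u))\<^sup>2)) \<longlongrightarrow> sqrt 0) (finite_subsets_at_top UNIV)"
    by (rule tendsto_real_sqrt)
  then have "((\<lambda>F. norm (trunc F u - u)) \<longlongrightarrow> 0) (finite_subsets_at_top UNIV)"
    by simp
  then show ?thesis
    by (simp add: tendsto_iff dist_norm)
qed

text \<open>A strict inequality is stable under small perturbations. This is what permits
  approximate eigenvectors of finite support throughout.\<close>

lemma ex_finite_trunc_small:
  assumes "bounded_linear S" "norm (S u) < e * norm u"
  obtains F where "finite F" "norm (S (trunc F u)) < e * norm (trunc F u)"
proof -
  have "((\<lambda>F. e * norm (trunc F u) - norm (S (trunc F u))) \<longlongrightarrow> e * norm u - norm (S u))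
      (finite_subsets_at_top UNIV)"
    by (intro tendsto_intros bounded_linear.tendsto[OF assms(1)] tendsto_trunc)
  then have "\<forall>\<^sub>F F in finite_subsets_at_top UNIV. 0 < e * norm (trunc F u) - norm (S (trunc F u))"
    using assms(2) by (intro order_tendstoD(1)) auto
  then obtain F where "finite F" "0 < e * norm (trunc F u) - norm (S (trunc F u))"
    unfolding eventually_finite_subsets_at_top by blast
  then show thesis using that by simp
qed

lemma ex_tail_small:
  fixes u :: "nat l2"
  assumes "e > 0"
  obtains m where "norm (trunc {m..} u) < e"
proof -
  have "\<forall>\<^sub>F F in finite_subsets_at_top UNIV. dist (trunc F u) u < e"
    using tendstoD[OF tendsto_trunc assms] .
  then obtain F where F: "finite F" "\<And>G. finite G \<Longrightarrow> F \<subseteq> G \<Longrightarrow> dist (trunc G u) u < e"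
    unfolding eventually_finite_subsets_at_top by auto
  obtain m where "F \<subseteq> {..<m}"
    using finite_nat_iff_bounded F(1) by auto
  with F(2)[of "{..<m}"] have "norm (trunc {..<m} u - u) < e" by (simp add: dist_norm)
  moreover have "u - trunc {..<m} u = trunc {m..} u"
    by (rule l2_eqI) (simp add: coord_trunc)
  ultimately show thesis using that[of m] by (simp add: norm_minus_commute)
qed

lemma ell2_norm_coord: "ell2_norm UNIV (coord u) = norm u"
  unfolding ell2_norm_def norm_l2_sq[symmetric] by simp

section \<open>Spectra of bounded symmetric complex-linear operators\<close>

locale symmetric_op =
  fixes T :: "'i l2 \<Rightarrow> 'i l2"
  assumes bounded: "bounded_linear T"
    and symmetric: "T u \<bullet> v = u \<bullet> T v"
    and complex_linear: "T (cscale z u) = cscale z (T u)"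
begin

definition shifted :: "complex \<Rightarrow> 'i l2 \<Rightarrow> 'i l2" where "shifted z u = T u - cscale z u"

definition bounded_below :: "complex \<Rightarrow> bool" where
  "bounded_below z \<longleftrightarrow> (\<exists>c>0. \<forall>u. c * norm u \<le> norm (shifted z u))"

lemma bounded_linear_shifted: "bounded_linear (shifted z)"
  unfolding shifted_def by (intro bounded_linear_sub bounded bounded_linear_cscale)

sublocale shifted: bounded_linear "shifted z" for z
  by (rule bounded_linear_shifted)

sublocale shifted: normal_op "shifted z" "shifted (cnj z)" for z
proof
  interpret T: bounded_linear T by (rule bounded)
  interpret C: bounded_linear "cscale w" for w by (rule bounded_linear_cscale)
  show "shifted z u \<bullet> v = u \<bullet> shifted (cnj z) v" for u v
    by (simp add: shifted_def inner_diff_left inner_diff_right symmetric inner_cscale)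
  show "shifted z (shifted (cnj z) u) = shifted (cnj z) (shifted z u)" for u
    by (simp add: shifted_def T.diff C.diff complex_linear cscale_commute[of z])
qed

lemma shifted_cscale: "shifted z (cscale w u) = cscale w (shifted z u)"
  by (rule l2_eqI) (simp add: shifted_def complex_linear algebra_simps)

text \<open>The quadratic form of a symmetric operator is real, so the imaginary part of the shift
  contributes orthogonally. Nonreal \<open>z\<close> are thereby reduced to real shifts.\<close>

lemma norm_shifted_sq: "(norm (shifted z u))\<^sup>2 = (norm (shifted (Re z) u))\<^sup>2 + (Im z)\<^sup>2 * (norm u)\<^sup>2"
proof -
  define S where "S = shifted (Re z) u"
  define w where "w = cscale (\<i> * Im z) u"
  have z: "z * x = complex_of_real (Re z) * x + \<i> * complex_of_real (Im z) * x" for x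
    by (metis complex_eq distrib_right)
  have "shifted z u = S - w"
    by (rule l2_eqI) (simp add: shifted_def S_def w_def z)
  \<comment> \<open>Multiplication by \<open>\<i> * Im z\<close> is antisymmetric and commutes with
    the symmetric operator \<open>shifted (Re z)\<close>, so the inner product equals its own
    negative.\<close>
  moreover have "S \<bullet> w = 0"
  proof -
    have "S \<bullet> w = u \<bullet> cscale (\<i> * Im z) S"
      using shifted.adjoint[of "complex_of_real (Re z)" u w]
      by (simp add: S_def w_def shifted_cscale)
    also have "\<dots> = - cscale (\<i> * Im z) u \<bullet> S"
      unfolding inner_minus_left inner_cscale inner_minus_right[symmetric]
      by (rule arg_cong[of _ _ "inner u"]) (simp add: l2_eqI)
    finally show ?thesis by (simp add: w_def inner_commute)
  qed
  moreover have "norm w = \<bar>Im z\<bar> * norm u"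
    by (simp add: w_def norm_mult)
  moreover have "(norm (S - w))\<^sup>2 = (norm S)\<^sup>2 + (norm w)\<^sup>2 - 2 * (S \<bullet> w)"
    unfolding power2_norm_eq_inner by (simp add: inner_diff_left inner_diff_right inner_commute)
  ultimately show ?thesis
    unfolding S_def by (simp add: power_mult_distrib)
qed

text \<open>One \<open>e\<close> pays for moving \<open>z\<close> to the real axis, a second one for
  moving \<open>Re z\<close> to a real point of the spectrum.\<close>

lemma near_not_bounded_below:
  assumes "v \<noteq> 0" "norm (shifted z v) \<le> e * norm v"
  obtains l where "cmod (l - z) \<le> 2 * e" "\<not> bounded_below l"
proof -
  have "norm (shifted (Re z) v) \<le> norm (shifted z v)"
    by (rule power2_le_imp_le) (simp_all add: norm_shifted_sq[of z])
  then have 1: "norm (shifted (Re z) v) \<le> e * norm v"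
    using assms(2) by simp
  have "(\<bar>Im z\<bar> * norm v)\<^sup>2 \<le> (norm (shifted z v))\<^sup>2"
    by (simp add: norm_shifted_sq[of z] power_mult_distrib)
  then have "\<bar>Im z\<bar> * norm v \<le> norm (shifted z v)"
    by (rule power2_le_imp_le) simp
  then have "\<bar>Im z\<bar> * norm v \<le> e * norm v"
    using assms(2) by simp
  then have 2: "\<bar>Im z\<bar> \<le> e" using assms(1) by simp
  obtain l :: real where l: "\<bar>l\<bar> \<le> e"
    "\<nexists>c. c > 0 \<and> (\<forall>u. c * norm u \<le> norm (shifted (Re z) u - l *\<^sub>R u))"
  proof (rule symmetric_near_spectrum[where B = "shifted (complex_of_real (Re z))" and v = v and e = e])
    show "bounded_linear (shifted (complex_of_real (Re z)))"
      by (rule bounded_linear_shifted)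
    show "shifted (complex_of_real (Re z)) u \<bullet> v = u \<bullet> shifted (complex_of_real (Re z)) v" for u v
      using shifted.adjoint[of "complex_of_real (Re z)"] by simp
  qed (use assms(1) 1 in auto)
  have eq: "shifted (Re z) u - l *\<^sub>R u = shifted (complex_of_real (Re z + l)) u" for u
    by (rule l2_eqI) (simp add: shifted_def scaleR_conv_of_real algebra_simps)
  have "cmod (complex_of_real (Re z + l) - z) \<le> \<bar>l\<bar> + \<bar>Im z\<bar>"
    using cmod_le[of "complex_of_real (Re z + l) - z"] by simp
  then have "cmod (complex_of_real (Re z + l) - z) \<le> 2 * e"
    using l(1) 2 by linarith
  moreover have "\<not> bounded_below (complex_of_real (Re z + l))"
    using l(2) unfolding bounded_below_def eq .
  ultimately show thesis by (rule that)
qed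

text \<open>A normal operator that is bounded below is already bijective, and the lower bound then
  bounds its inverse: there is no residual spectrum.\<close>

lemma spectrum_iff_not_bounded_below:
  assumes f: "\<And>u. coord (T u) = f (coord u)"
  shows "z \<in> spectrum UNIV f \<longleftrightarrow> \<not> bounded_below z"
proof -
  define S where "S = shift_op f z"
  have S: "S (coord u) = coord (shifted z u)" for u
    by (auto simp: S_def shift_op_def shifted_def f)
  have ell2: "ell2 UNIV = range coord"
    by (metis coord type_definition.Rep_range type_definition_l2)
  have "boundedly_invertible UNIV S \<longleftrightarrow> bounded_below z"
  proof
    assume "boundedly_invertible UNIV S"
    then obtain C where bij: "bij_betw S (ell2 UNIV) (ell2 UNIV)"
      and C: "\<And>v. v \<in> ell2 UNIV \<Longrightarrow> ell2_norm UNIV (inv_into (ell2 UNIV) S v) \<le> C * ell2_norm UNIV v"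
      by (auto simp: boundedly_invertible_def)
    \<comment> \<open>The constant \<open>C\<close> comes without a sign; \<open>max C 1\<close> is
      positive and can be inverted.\<close>
    have "norm u \<le> max C 1 * norm (shifted z u)" for u
    proof -
      have "inv_into (ell2 UNIV) S (coord (shifted z u)) = coord u"
        using bij_betw_inv_into_left[OF bij coord[of u]] by (simp add: S)
      then have "norm u \<le> C * norm (shifted z u)"
        using C[OF coord, of "shifted z u"] by (simp add: ell2_norm_coord)
      also have "\<dots> \<le> max C 1 * norm (shifted z u)" by (intro mult_right_mono) auto
      finally show ?thesis .
    qed
    then show "bounded_below z"
      unfolding bounded_below_def
      by (intro exI[of _ "1 / max C 1"]) (auto simp: field_simps)
  next
    assume "bounded_below z"
    then obtain c where c: "c > 0" "\<And>u. c * norm u \<le> norm (shifted z u)"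
      by (auto simp: bounded_below_def)
    have bij: "bij (shifted z)"
      using shifted.bij_if_bounded_below[OF c] .
    have bij': "bij_betw S (ell2 UNIV) (ell2 UNIV)"
    proof (rule bij_betwI')
      show "x \<in> ell2 UNIV \<Longrightarrow> y \<in> ell2 UNIV \<Longrightarrow> (S x = S y) = (x = y)" for x y
        using bij by (auto simp: ell2 S coord_inject bij_def inj_eq)
      show "x \<in> ell2 UNIV \<Longrightarrow> S x \<in> ell2 UNIV" for x
        by (auto simp: ell2 S)
      show "y \<in> ell2 UNIV \<Longrightarrow> \<exists>x\<in>ell2 UNIV. y = S x" for y
        using bij unfolding ell2 by (auto simp: S bij_def surj_def coord_inject)
    qed
    have "ell2_norm UNIV (inv_into (ell2 UNIV) S v) \<le> (1 / c) * ell2_norm UNIV v"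
      if "v \<in> ell2 UNIV" for v
    proof -
      obtain y where "v = coord y" using \<open>v \<in> ell2 UNIV\<close> unfolding ell2 by blast
      moreover obtain u where "y = shifted z u" using bij by (metis bij_pointE)
      ultimately have u: "v = coord (shifted z u)" by simp
      have "inv_into (ell2 UNIV) S v = coord u"
        using bij_betw_inv_into_left[OF bij' coord[of u]] by (simp add: S u)
      then show ?thesis using c(1) c(2)[of u] by (simp add: u ell2_norm_coord field_simps)
    qed
    with bij' show "boundedly_invertible UNIV S"
      unfolding boundedly_invertible_def by blast
  qed
  then show ?thesis by (simp add: spectrum_def S_def)
qed

end

subsection \<open>Jacobi operators\<close>

text \<open>A partially defined weighted shift. Super-, main and subdiagonal of a Jacobi matrix are
  three of these, on the line as on the half-line, so boundedness and symmetry are proved once for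
  both.\<close>

definition wshift :: "'i set \<Rightarrow> ('i \<Rightarrow> 'i) \<Rightarrow> ('i \<Rightarrow> real) \<Rightarrow> 'i l2 \<Rightarrow> 'i l2" where
  "wshift A f w u = Abs_l2 (\<lambda>i. if i \<in> A then complex_of_real (w i) * coord u (f i) else 0)"

context
  fixes A :: "'i set" and f :: "'i \<Rightarrow> 'i" and w :: "'i \<Rightarrow> real" and M :: real
  assumes inj: "inj_on f A" and w: "\<And>i. i \<in> A \<Longrightarrow> \<bar>w i\<bar> \<le> M"
begin

lemma wshift_sum_le:
  assumes "finite F"
  shows "(\<Sum>i\<in>F. (cmod (if i \<in> A then complex_of_real (w i) * coord u (f i) else 0))\<^sup>2) \<le> (M * norm u)\<^sup>2"
proof -
  have "(\<Sum>i\<in>F. (cmod (if i \<in> A then complex_of_real (w i) * coord u (f i) else 0))\<^sup>2)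
      = (\<Sum>i\<in>F \<inter> A. (cmod (complex_of_real (w i) * coord u (f i)))\<^sup>2)"
    using assms by (intro sum.mono_neutral_cong_right) auto
  also have "\<dots> \<le> (\<Sum>i\<in>F \<inter> A. M\<^sup>2 * (cmod (coord u (f i)))\<^sup>2)"
  proof (rule sum_mono)
    fix i assume "i \<in> F \<inter> A"
    then have "\<bar>w i\<bar>\<^sup>2 \<le> M\<^sup>2" by (intro power_mono w) auto
    then show "(cmod (complex_of_real (w i) * coord u (f i)))\<^sup>2 \<le> M\<^sup>2 * (cmod (coord u (f i)))\<^sup>2"
      by (simp add: norm_mult power_mult_distrib mult_right_mono)
  qed
  also have "\<dots> = M\<^sup>2 * (\<Sum>j\<in>f ` (F \<inter> A). (cmod (coord u j))\<^sup>2)"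
    using inj_on_subset[OF inj] by (subst sum.reindex) (auto simp: sum_distrib_left)
  also have "\<dots> \<le> M\<^sup>2 * (norm u)\<^sup>2"
    using assms by (intro mult_left_mono sum_le_norm_l2_sq) auto
  finally show ?thesis by (simp add: power_mult_distrib)
qed

lemma coord_wshift: "coord (wshift A f w u) i = (if i \<in> A then complex_of_real (w i) * coord u (f i) else 0)"
  unfolding wshift_def by (subst coord_inverse_ell2) (auto intro!: ell2_UNIV_I wshift_sum_le)

lemma bounded_linear_wshift: "bounded_linear (wshift A f w)"
proof (rule bounded_linear_intro[where K = "\<bar>M\<bar>"])
  show "norm (wshift A f w u) \<le> norm u * \<bar>M\<bar>" for u
  proof -
    have "(norm (wshift A f w u))\<^sup>2 \<le> (M * norm u)\<^sup>2"
      by (intro norm_l2_sq_leI) (simp only: coord_wshift wshift_sum_le)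
    then have "\<bar>norm (wshift A f w u)\<bar> \<le> \<bar>M * norm u\<bar>"
      by (simp only: abs_le_square_iff)
    then show ?thesis by (simp add: abs_mult mult.commute)
  qed
qed (auto intro!: l2_eqI simp: coord_wshift algebra_simps scaleR_conv_of_real)

lemma wshift_cscale: "wshift A f w (cscale z u) = cscale z (wshift A f w u)"
  by (rule l2_eqI) (simp add: coord_wshift)

end

text \<open>The substitution \<open>j = f i\<close> moves the shift to the other factor; the weight
  is then read off at \<open>g j\<close>.\<close>

lemma inner_wshift:
  assumes f: "bij_betw f A B" and g: "bij_betw g B A" "\<And>i. i \<in> A \<Longrightarrow> g (f i) = i"
    and w: "\<And>i. i \<in> A \<Longrightarrow> \<bar>w i\<bar> \<le> M"
  shows "wshift A f w u \<bullet> v = u \<bullet> wshift B g (\<lambda>j. w (g j)) v"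
proof -
  have w': "\<And>j. j \<in> B \<Longrightarrow> \<bar>w (g j)\<bar> \<le> M"
    using g(1) w by (auto simp: bij_betw_def)
  note c = coord_wshift[OF bij_betw_imp_inj_on[OF f] w] coord_wshift[OF bij_betw_imp_inj_on[OF g(1)] w']
  have "wshift A f w u \<bullet> v = (\<Sum>\<^sub>\<infinity>i\<in>A. w i * (coord u (f i) \<bullet> coord v i))"
    unfolding inner_l2_def
    by (rule infsum_cong_neutral) (auto simp: c simp flip: scaleR_conv_of_real)
  also have "\<dots> = (\<Sum>\<^sub>\<infinity>i\<in>A. w (g (f i)) * (coord u (f i) \<bullet> coord v (g (f i))))"
    by (rule infsum_cong) (simp add: g)
  also have "\<dots> = (\<Sum>\<^sub>\<infinity>j\<in>B. w (g j) * (coord u j \<bullet> coord v (g j)))"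
    by (rule infsum_reindex_bij_betw[OF f])
  also have "\<dots> = u \<bullet> wshift B g (\<lambda>j. w (g j)) v"
    unfolding inner_l2_def
    by (rule infsum_cong_neutral) (auto simp: c simp flip: scaleR_conv_of_real)
  finally show ?thesis .
qed

lemma symmetric_op_wshift:
  assumes f: "bij_betw f A B" and g: "bij_betw g B A" "\<And>i. i \<in> A \<Longrightarrow> g (f i) = i" "\<And>j. j \<in> B \<Longrightarrow> f (g j) = j"
    and a: "\<And>i. i \<in> A \<Longrightarrow> \<bar>a i\<bar> \<le> M" and b: "\<And>i. i \<in> D \<Longrightarrow> \<bar>b i\<bar> \<le> M"
  shows "symmetric_op (\<lambda>u. wshift A f a u + wshift D (\<lambda>i. i) b u + wshift B g (\<lambda>j. a (g j)) u)"
proof -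
  have a': "\<And>j. j \<in> B \<Longrightarrow> \<bar>a (g j)\<bar> \<le> M"
    using g(1) a by (auto simp: bij_betw_def)
  have fg: "inj_on f A" "inj_on g B" "inj_on (\<lambda>i. i) D"
    using f g by (auto simp: bij_betw_def)
  have 0: "wshift A f a u \<bullet> v = u \<bullet> wshift B g (\<lambda>j. a (g j)) v" for u v
    by (rule inner_wshift[OF f g(1,2) a])
  have 1: "wshift B g (\<lambda>j. a (g j)) u \<bullet> v = u \<bullet> wshift A f a v" for u v
    using 0[of v u] by (simp add: inner_commute)
  have 2: "wshift D (\<lambda>i. i) b u \<bullet> v = u \<bullet> wshift D (\<lambda>i. i) b v" for u v
    using inner_wshift[where f = "\<lambda>i. i" and g = "\<lambda>i. i" and A = D and B = D and w = b and M = M, OF _ _ _ b] by (simp add: bij_betw_def)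
  interpret C: bounded_linear "cscale z" for z :: complex by (rule bounded_linear_cscale)
  show ?thesis
  proof (rule symmetric_op.intro)
    show "bounded_linear (\<lambda>u. wshift A f a u + wshift D (\<lambda>i. i) b u + wshift B g (\<lambda>j. a (g j)) u)"
      by (intro bounded_linear_add bounded_linear_wshift[OF fg(1) a] bounded_linear_wshift[OF fg(2) a']
          bounded_linear_wshift[OF fg(3) b])
    show "(wshift A f a u + wshift D (\<lambda>i. i) b u + wshift B g (\<lambda>j. a (g j)) u) \<bullet> v =
        u \<bullet> (wshift A f a v + wshift D (\<lambda>i. i) b v + wshift B g (\<lambda>j. a (g j)) v)" for u v
      unfolding inner_add_left inner_add_right 0 1 2 by simp
    show "wshift A f a (cscale z u) + wshift D (\<lambda>i. i) b (cscale z u) + wshift B g (\<lambda>j. a (g j)) (cscale z u) =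
        cscale z (wshift A f a u + wshift D (\<lambda>i. i) b u + wshift B g (\<lambda>j. a (g j)) u)" for z u
      by (simp add: C.add wshift_cscale[OF fg(1) a] wshift_cscale[OF fg(2) a'] wshift_cscale[OF fg(3) b])
  qed
qed

section \<open>Jacobi matrices as bounded symmetric operators\<close>

lemma jacobi_int:
  fixes a b :: "int \<Rightarrow> real" and u :: "int \<Rightarrow> complex"
  shows "jacobi UNIV a b u m = a m * u (m + 1) + b m * u m + a (m - 1) * u (m - 1)"
proof -
  have "jacobi UNIV a b u m = (\<Sum>\<^sub>\<infinity>n. complex_of_real (jacobi_entry a b m n) * u n)"
    by (simp add: jacobi_def)
  also have "\<dots> = (\<Sum>\<^sub>\<infinity>n\<in>{m - 1, m, m + 1}. complex_of_real (jacobi_entry a b m n) * u n)"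
    by (rule infsum_cong_neutral) (auto simp: jacobi_entry_def)
  also have "\<dots> = (\<Sum>n\<in>{m - 1, m, m + 1}. complex_of_real (jacobi_entry a b m n) * u n)"
    by (rule infsum_finite) simp
  finally show ?thesis by (simp add: jacobi_entry_def)
qed

lemma jacobi_nat:
  fixes a b :: "nat \<Rightarrow> real" and u :: "nat \<Rightarrow> complex"
  assumes "m \<ge> 1"
  shows "jacobi {1..} a b u m =
    a m * u (Suc m) + b m * u m + (if m \<ge> 2 then a (m - 1) * u (m - 1) else 0)"
proof -
  have "jacobi {1..} a b u m =
      (\<Sum>\<^sub>\<infinity>n\<in>{1..}. complex_of_real (jacobi_entry a b m n) * u n)"
    unfolding jacobi_def using assms by simp
  also have "\<dots> = (\<Sum>\<^sub>\<infinity>n\<in>{m - 1, m, m + 1} \<inter> {1..}. complex_of_real (jacobi_entry a b m n) * u n)"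
    by (rule infsum_cong_neutral) (auto simp: jacobi_entry_def)
  also have "\<dots> = (\<Sum>n\<in>{m - 1, m, m + 1} \<inter> {1..}. complex_of_real (jacobi_entry a b m n) * u n)"
    by (rule infsum_finite) simp
  \<comment> \<open>In row 1 the lower neighbour is the index 0 outside the half-line, so it drops
    out.\<close>
  also have "{m - 1, m, m + 1} \<inter> {1..} = (if m \<ge> 2 then {m - 1, m, m + 1} else {m, m + 1})"
    using assms by auto
  finally show ?thesis by (cases m) (auto simp: jacobi_entry_def)
qed

lemma jacobi_outside: "m \<notin> I \<Longrightarrow> jacobi I a b u m = 0"
  by (simp add: jacobi_def)

definition jac_op :: "'i::linordered_semidom set \<Rightarrow> ('i \<Rightarrow> real) \<Rightarrow> ('i \<Rightarrow> real) \<Rightarrow> 'i l2 \<Rightarrow> 'i l2" where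
  "jac_op I a b u = Abs_l2 (jacobi I a b (coord u))"

context
  fixes a b :: "int \<Rightarrow> real" and M :: real
  assumes M: "\<And>l. \<bar>a l\<bar> \<le> M" "\<And>l. \<bar>b l\<bar> \<le> M"
begin

lemma jac_op_int_eq:
  shows coord_jac_op_int: "coord (jac_op UNIV a b u) = jacobi UNIV a b (coord u)"
    and "jac_op UNIV a b u = wshift UNIV (\<lambda>l. l + 1) a u + wshift UNIV (\<lambda>l. l) b u
      + wshift UNIV (\<lambda>l. l - 1) (\<lambda>l. a (l - 1)) u" (is "_ = ?w")
proof -
  have inj: "inj (\<lambda>l :: int. l + 1)" "inj (\<lambda>l :: int. l)" "inj (\<lambda>l :: int. l - 1)"
    by (auto simp: inj_def)
  have eq: "coord ?w = jacobi UNIV a b (coord u)"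
    by (rule ext) (simp add: jacobi_int coord_wshift[OF inj(1) M(1)] coord_wshift[OF inj(2) M(2)]
        coord_wshift[OF inj(3) M(1)])
  then show "coord (jac_op UNIV a b u) = jacobi UNIV a b (coord u)" "jac_op UNIV a b u = ?w"
    unfolding jac_op_def eq[symmetric] coord_inverse by simp_all
qed

lemma symmetric_op_jac_int: "symmetric_op (jac_op UNIV a b)"
proof -
  have "bij (\<lambda>l :: int. l + 1)" "bij (\<lambda>l :: int. l - 1)"
    by (rule bij_betw_byWitness[where f' = "\<lambda>l. l - 1"]; simp)
       (rule bij_betw_byWitness[where f' = "\<lambda>l. l + 1"]; simp)
  from symmetric_op_wshift[OF this, where a = a and M = M and b = b and D = UNIV] M show ?thesis
    unfolding jac_op_int_eq(2)[abs_def] by simp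
qed

end

context
  fixes a b :: "nat \<Rightarrow> real" and M :: real
  assumes M: "\<And>n. n \<ge> 1 \<Longrightarrow> \<bar>a n\<bar> \<le> M" "\<And>n. n \<ge> 1 \<Longrightarrow> \<bar>b n\<bar> \<le> M"
begin

lemma jac_op_nat_eq:
  shows coord_jac_op_nat: "coord (jac_op {1..} a b u) = jacobi {1..} a b (coord u)"
    and "jac_op {1..} a b u = wshift {1..} Suc a u + wshift {1..} (\<lambda>n. n) b u
      + wshift {2..} (\<lambda>n. n - 1) (\<lambda>n. a (n - 1)) u" (is "_ = ?w")
proof -
  have inj: "inj_on Suc {1..}" "inj_on (\<lambda>n :: nat. n) {1..}" "inj_on (\<lambda>n :: nat. n - 1) {2..}"
    by (auto simp: inj_on_def)
  have M': "\<And>i. i \<in> {1..} \<Longrightarrow> \<bar>a i\<bar> \<le> M" "\<And>i. i \<in> {1..} \<Longrightarrow> \<bar>b i\<bar> \<le> M"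
    "\<And>i. i \<in> {2..} \<Longrightarrow> \<bar>a (i - 1)\<bar> \<le> M"
    using M by auto
  have "coord ?w m = jacobi {1..} a b (coord u) m" for m
    using coord_wshift[where w = a, OF inj(1) M'(1), of u m]
      coord_wshift[where w = b, OF inj(2) M'(2), of u m]
      coord_wshift[where w = "\<lambda>i. a (i - 1)", OF inj(3) M'(3), of u m]
    by (cases "m \<ge> 1") (auto simp: jacobi_nat jacobi_outside simp del: One_nat_def)
  then have eq: "coord ?w = jacobi {1..} a b (coord u)" by blast
  then show "coord (jac_op {1..} a b u) = jacobi {1..} a b (coord u)" "jac_op {1..} a b u = ?w"
    unfolding jac_op_def eq[symmetric] coord_inverse by simp_all
qed

lemma symmetric_op_jac_nat: "symmetric_op (jac_op {1..} a b)"
proof -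
  have "bij_betw Suc {1..} {2..}"
    by (rule bij_betw_byWitness[where f' = "\<lambda>n. n - 1"]) auto
  moreover have "bij_betw (\<lambda>n. n - 1) {2..} {1 :: nat..}"
    by (rule bij_betw_byWitness[where f' = Suc]) auto
  ultimately show ?thesis
    using symmetric_op_wshift[where f = Suc and A = "{1..}" and B = "{2..}" and g = "\<lambda>n. n - 1"
        and a = a and M = M and b = b and D = "{1..}"] M
    unfolding jac_op_nat_eq(2)[abs_def] by auto
qed

end

subsection \<open>Singular Weyl sequences and non-closed range\<close>

declare One_nat_def [simp del]

lemma ell2_iff_coord: "x \<in> ell2 I \<longleftrightarrow> (\<exists>u. x = coord u \<and> (\<forall>i. i \<notin> I \<longrightarrow> coord u i = 0))"
proof -
  have "(\<lambda>i. (cmod (x i))\<^sup>2) summable_on I \<longleftrightarrow> x \<in> ell2 UNIV" if "\<forall>i. i \<notin> I \<longrightarrow> x i = 0"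
    unfolding ell2_UNIV_iff using that by (intro summable_on_cong_neutral) auto
  then have "x \<in> ell2 I \<longleftrightarrow> x \<in> ell2 UNIV \<and> (\<forall>i. i \<notin> I \<longrightarrow> x i = 0)"
    by (auto simp: ell2_def)
  then show ?thesis using coord coord_inverse_ell2 by metis
qed

lemma ell2_norm_coord_subset:
  assumes "\<And>i. i \<notin> I \<Longrightarrow> coord u i = 0"
  shows "ell2_norm I (coord u) = norm u"
proof -
  have "(\<Sum>\<^sub>\<infinity>i\<in>I. (cmod (coord u i))\<^sup>2) = (\<Sum>\<^sub>\<infinity>i. (cmod (coord u i))\<^sup>2)"
    using assms by (intro infsum_cong_neutral) auto
  then show ?thesis by (simp add: ell2_norm_def flip: norm_l2_sq)
qed

lemma norm_trunc_le_sum: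
  assumes "finite F"
  shows "norm (trunc F u) \<le> (\<Sum>i\<in>F. cmod (coord u i))"
proof -
  have "(norm (trunc F u))\<^sup>2 = (\<Sum>i\<in>F. (cmod (coord u i))\<^sup>2)"
    using norm_l2_sq_finite[OF assms, of "trunc F u"] by (simp add: coord_trunc)
  then have "norm (trunc F u) = L2_set (\<lambda>i. cmod (coord u i)) F"
    unfolding L2_set_def by (metis norm_ge_zero real_sqrt_unique)
  also have "\<dots> \<le> (\<Sum>i\<in>F. cmod (coord u i))"
    by (rule L2_set_le_sum) simp
  finally show ?thesis .
qed

locale half_line_jacobi =
  fixes a b :: "nat \<Rightarrow> real" and M :: real
  assumes a_pos: "n \<ge> 1 \<Longrightarrow> a n > 0"
    and a_bound: "n \<ge> 1 \<Longrightarrow> \<bar>a n\<bar> \<le> M"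
    and b_bound: "n \<ge> 1 \<Longrightarrow> \<bar>b n\<bar> \<le> M"
begin

sublocale symmetric_op "jac_op {1..} a b"
  by (rule symmetric_op_jac_nat[OF a_bound b_bound])

lemma coord_shifted:
  assumes "n \<ge> 1"
  shows "coord (shifted z u) n = a n * coord u (Suc n) + b n * coord u n
    + (if n \<ge> 2 then a (n - 1) * coord u (n - 1) else 0) - z * coord u n"
  by (simp add: shifted_def coord_jac_op_nat[OF a_bound b_bound] jacobi_nat[OF assms])

lemma coord_shifted_0: "coord (shifted z u) 0 = - z * coord u 0"
  by (simp add: shifted_def coord_jac_op_nat[OF a_bound b_bound] jacobi_outside)

lemma shift_op_coord: "shift_op (jacobi {1..} a b) z (coord u) = coord (shifted z u)"
  by (rule ext) (simp add: shift_op_def shifted_def coord_jac_op_nat[OF a_bound b_bound])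

lemma ell2_half: "x \<in> ell2 {1 :: nat..} \<longleftrightarrow> (\<exists>u. x = coord u \<and> coord u 0 = 0)"
proof -
  have "(\<forall>i. i \<notin> {1 :: nat..} \<longrightarrow> coord u i = 0) \<longleftrightarrow> coord u 0 = 0" for u
    by (auto simp: not_le)
  then show ?thesis unfolding ell2_iff_coord by (simp only:)
qed

lemma ell2_norm_half: "coord u (0 :: nat) = 0 \<Longrightarrow> ell2_norm {1..} (coord u) = norm u"
  by (rule ell2_norm_coord_subset) (simp add: not_le)

text \<open>The strict inequality already excludes \<open>u = 0\<close>.\<close>

definition weyl :: "complex \<Rightarrow> bool" where
  "weyl z \<longleftrightarrow> (\<forall>e>0. \<forall>N. \<exists>u. finite {n. coord u n \<noteq> 0} \<and> (\<forall>n<N. coord u n = 0) \<and>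
    norm (shifted z u) < e * norm u)"

text \<open>As \<open>a m\<close> is nonzero, row \<open>m\<close> of the equation determines
  \<open>h (Suc m)\<close> from earlier entries. The sequence \<open>h\<close> is arbitrary, so that
  formal series outside \<open>ell2\<close> are covered.\<close>

lemma formal_kernel_zero:
  assumes h: "\<And>n. n \<ge> 1 \<Longrightarrow> jacobi {1..} a b h n = z * h n" and "h 1 = 0" and "n \<ge> 1"
  shows "h n = 0"
  using \<open>n \<ge> 1\<close>
proof (induction n rule: less_induct)
  case (less n)
  show ?case
  proof (cases "n = 1")
    case False
    then obtain m where m: "n = Suc m" "m \<ge> 1" using less.prems by (cases n) auto
    have "h m = 0" "m \<ge> 2 \<Longrightarrow> h (m - 1) = 0"
      using less.IH[of m] less.IH[of "m - 1"] m by auto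
    then have "a m * h (Suc m) = 0"
      using h[OF m(2)] jacobi_nat[OF m(2), of a b h] by (auto split: if_splits)
    then show ?thesis using a_pos[OF m(2)] m by simp
  qed (use assms in simp)
qed

lemma kernel_zero:
  assumes "shifted z u = 0" "coord u 0 = 0" "coord u 1 = 0"
  shows "u = 0"
proof (rule l2_eqI)
  fix n
  have "jacobi {1..} a b (coord u) n = z * coord u n" if "n \<ge> 1" for n
    using coord_shifted[OF that, of z u] assms(1) by (simp add: jacobi_nat[OF that])
  from formal_kernel_zero[of "coord u" z, OF this assms(3), of n] show "coord u n = coord 0 n"
    using assms(2) by (cases "n = 0") auto
qed

text \<open>
  Non-closedness of the range: unit vectors \<open>u k\<close> with disjoint supports and summable \<open>(J - z) (u k)\<close>
  give, for a 0-1 sequence \<open>s\<close> with infinitely many ones, a formal series \<open>f s = \<Sum>k. s k * u k\<close> outside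
  \<open>ell2\<close> with \<open>(J - z) (f s)\<close> in the closure of the range. If the range were closed, each \<open>f s\<close> would differ from
  an \<open>ell2\<close> vector by a formal solution of \<open>(J - z) g = 0\<close>. These form a one-dimensional space, so
  two such series with disjoint supports cannot both exist.
\<close>

context
  fixes z :: complex and u :: "nat \<Rightarrow> nat l2" and p q :: "nat \<Rightarrow> nat"
  assumes norm_u: "\<And>k. norm (u k) = 1"
    and shifted_u: "\<And>k. norm (shifted z (u k)) \<le> (1 / 2) ^ k"
    and supp_u: "\<And>k n. coord (u k) n \<noteq> 0 \<Longrightarrow> p k \<le> n \<and> n < q k"
    and p_ge: "\<And>k. p k \<ge> Suc k"
    and q_le: "\<And>k. q k \<le> p (Suc k)"
begin

text \<open>By \<open>p_ge\<close> the vectors \<open>u k\<close> with \<open>k > n\<close> vanish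
  at \<open>n\<close>, so this finite sum is the whole pointwise series.\<close>

definition formal_sum :: "(nat \<Rightarrow> real) \<Rightarrow> nat \<Rightarrow> complex" where
  "formal_sum s n = (\<Sum>k\<le>n. s k * coord (u k) n)"

lemma disjoint_u: "j < k \<Longrightarrow> q j \<le> p k"
proof (induction k)
  case (Suc k)
  \<comment> \<open>A unit vector has a nonzero entry, so its window is nonempty.\<close>
  have "p k \<le> q k"
    using supp_u[of k] norm_u[of k] by (metis l2_eqI le_less_trans less_imp_le norm_zero zero_l2.rep_eq zero_neq_one)
  with Suc q_le[of k] show ?case by (cases "j = k") auto
qed simp

lemma formal_sum_block:
  assumes "p k \<le> n" "n < q k"
  shows "formal_sum s n = s k * coord (u k) n"
proof -
  have "coord (u j) n = 0" if "j \<noteq> k" for j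
    using supp_u[of j n] disjoint_u[of j k] disjoint_u[of k j] assms that
    by (metis le_less_trans linorder_neqE_nat not_le order_less_le_trans)
  moreover have "k \<le> n" using p_ge[of k] assms by simp
  ultimately show ?thesis
    unfolding formal_sum_def by (subst sum.remove[of _ k]) auto
qed

text \<open>Far-out blocks of \<open>x\<close> have norm \<open>cmod c\<close>, while the tails of a
  square-summable \<open>x\<close> tend to zero.\<close>

lemma block_coefficient_zero:
  assumes blocks: "\<And>k n. k \<in> K \<Longrightarrow> p k \<le> n \<Longrightarrow> n < q k \<Longrightarrow> coord x n = c * coord (u k) n"
    and "infinite K"
  shows "c = 0"
proof (rule ccontr)
  assume "c \<noteq> 0"
  then obtain m where m: "norm (trunc {m..} x) < cmod c"
    using ex_tail_small[of "cmod c" x] by auto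
  obtain k where k: "k \<in> K" "k \<ge> m"
    using assms(2) by (meson infinite_nat_iff_unbounded_le)
  have "cscale c (u k) = trunc {p k..<q k} (trunc {m..} x)"
    using blocks[OF k(1)] supp_u[of k] p_ge[of k] k(2)
    by (intro l2_eqI) (auto simp: coord_trunc)
  then have "cmod c = norm (trunc {p k..<q k} (trunc {m..} x))"
    using norm_cscale[of c "u k"] by (simp add: norm_u)
  also have "\<dots> \<le> norm (trunc {m..} x)" by (rule norm_trunc_le)
  finally show False using m by simp
qed

lemma ex_formal_kernel:
  assumes closed: "ell2_closed {1..} (shift_op (jacobi {1..} a b) z ` ell2 {1..})"
    and s: "\<And>k. \<bar>s k\<bar> \<le> 1"
  obtains w where "coord w 0 = 0"
    "\<And>n. n \<ge> 1 \<Longrightarrow> jacobi {1..} a b (\<lambda>n. formal_sum s n - coord w n) n = z * (formal_sum s n - coord w n)"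
proof -
  define F where "F K = (\<Sum>k<K. s k *\<^sub>R u k)" for K
  have u0: "coord (u k) n = 0" if "n \<le> k" for k n
    using supp_u[of k n] p_ge[of k] that by auto
  have F0: "coord (F K) 0 = 0" for K
    by (simp add: F_def coord_sum u0)
  have F: "coord (F K) n = formal_sum s n" if "K > n" for K n
  proof -
    have "coord (F K) n = (\<Sum>k<K. s k * coord (u k) n)"
      by (simp add: F_def coord_sum scaleR_conv_of_real)
    also have "\<dots> = formal_sum s n"
      unfolding formal_sum_def using that u0 by (intro sum.mono_neutral_right) auto
    finally show ?thesis .
  qed
  have "summable (\<lambda>k. s k *\<^sub>R shifted z (u k))"
  proof (rule summable_comparison_test')
    show "summable (\<lambda>k. (1 / 2 :: real) ^ k)" by simp
    show "norm (s k *\<^sub>R shifted z (u k)) \<le> (1 / 2) ^ k" if "k \<ge> 0" for k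
      using mult_mono[OF s[of k] shifted_u[of k]] by simp
  qed
  then obtain v where "(\<lambda>K. \<Sum>k<K. s k *\<^sub>R shifted z (u k)) \<longlonglongrightarrow> v"
    by (auto simp: summable_def sums_def)
  moreover have "(\<Sum>k<K. s k *\<^sub>R shifted z (u k)) = shifted z (F K)" for K
    by (simp add: F_def shifted.sum shifted.scaleR)
  ultimately have v: "(\<lambda>K. shifted z (F K)) \<longlonglongrightarrow> v" by simp
  have v0: "coord v 0 = 0"
    using LIMSEQ_unique[OF tendsto_coord[OF v, of 0]] by (simp add: coord_shifted_0 F0)
  have "(\<lambda>K. norm (shifted z (F K) - v)) \<longlonglongrightarrow> 0"
    using v by (simp add: LIM_zero tendsto_norm_zero)
  moreover have "ell2_norm {1..} (\<lambda>i. coord (shifted z (F K)) i - coord v i) = norm (shifted z (F K) - v)" for K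
    using ell2_norm_half[of "shifted z (F K) - v"] by (simp add: coord_shifted_0 F0 v0)
  moreover have "coord (shifted z (F K)) \<in> shift_op (jacobi {1..} a b) z ` ell2 {1..}" for K
    unfolding shift_op_coord[symmetric] using F0 ell2_half by blast
  moreover have "coord v \<in> ell2 {1..}" using v0 ell2_half by blast
  ultimately have "coord v \<in> shift_op (jacobi {1..} a b) z ` ell2 {1..}"
    using closed[unfolded ell2_closed_def, rule_format, of "\<lambda>K. coord (shifted z (F K))" "coord v"]
    by simp
  then obtain w where w: "coord w 0 = 0" "v = shifted z w"
    unfolding image_iff Bex_def ell2_half by (metis coord_inject shift_op_coord)
  have "jacobi {1..} a b (\<lambda>n. formal_sum s n - coord w n) n = z * (formal_sum s n - coord w n)"
    if n: "n \<ge> 1" for n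
  proof -
    \<comment> \<open>Row \<open>n\<close> sees no entry beyond \<open>n + 1\<close>, and up to
      there \<open>F K\<close> agrees with the formal series.\<close>
    have "coord (shifted z (F K)) n = jacobi {1..} a b (formal_sum s) n - z * formal_sum s n"
      if "K \<ge> n + 2" for K
      using that by (simp add: coord_shifted[OF n] jacobi_nat[OF n] F)
    then have "(\<lambda>K. coord (shifted z (F K)) n) \<longlonglongrightarrow> jacobi {1..} a b (formal_sum s) n - z * formal_sum s n"
      by (intro tendsto_eventually eventually_sequentiallyI)
    then have "coord v n = jacobi {1..} a b (formal_sum s) n - z * formal_sum s n"
      using LIMSEQ_unique tendsto_coord[OF v] by blast
    then show ?thesis
      unfolding w(2) by (simp add: coord_shifted[OF n] jacobi_nat[OF n] algebra_simps split: if_splits)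
  qed
  with w(1) show thesis by (rule that)
qed

lemma not_closed_range: "\<not> ell2_closed {1..} (shift_op (jacobi {1..} a b) z ` ell2 {1..})"
proof
  assume closed: "ell2_closed {1..} (shift_op (jacobi {1..} a b) z ` ell2 {1..})"
  define s1 s2 :: "nat \<Rightarrow> real" where "s1 k = of_bool (even k)" and "s2 k = of_bool (odd k)" for k
  obtain w1 where w1: "\<And>n. n \<ge> 1 \<Longrightarrow> jacobi {1..} a b (\<lambda>n. formal_sum s1 n - coord w1 n) n = z * (formal_sum s1 n - coord w1 n)"
    by (rule ex_formal_kernel[OF closed, of s1]) (auto simp: s1_def)
  obtain w2 where w2: "\<And>n. n \<ge> 1 \<Longrightarrow> jacobi {1..} a b (\<lambda>n. formal_sum s2 n - coord w2 n) n = z * (formal_sum s2 n - coord w2 n)"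
    by (rule ex_formal_kernel[OF closed, of s2]) (auto simp: s2_def)
  define g1 g2 where "g1 n = formal_sum s1 n - coord w1 n" and "g2 n = formal_sum s2 n - coord w2 n" for n
  note w1 = w1[folded g1_def] and w2 = w2[folded g2_def]
  have blocks: "formal_sum s1 n = of_bool (even k) * coord (u k) n"
    "formal_sum s2 n = of_bool (odd k) * coord (u k) n" "n \<ge> 1" if "p k \<le> n" "n < q k" for k n
    using formal_sum_block[OF that] p_ge[of k] that by (auto simp: s1_def s2_def)
  have inf: "infinite {k :: nat. even k}" "infinite {k :: nat. odd k}"
    unfolding infinite_nat_iff_unbounded_le mem_Collect_eq
    by (meson dvd_triv_left le_add2 mult_2 even_Suc le_SucI nat_le_linear order_refl)+
  \<comment> \<open>This combination of two formal solutions vanishes at 1, hence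
    everywhere.\<close>
  have "jacobi {1..} a b (\<lambda>n. g2 1 * g1 n - g1 1 * g2 n) n = z * (g2 1 * g1 n - g1 1 * g2 n)" if "n \<ge> 1" for n
  proof -
    have "jacobi {1..} a b (\<lambda>n. g2 1 * g1 n - g1 1 * g2 n) n = g2 1 * jacobi {1..} a b g1 n - g1 1 * jacobi {1..} a b g2 n"
      by (simp add: jacobi_nat[OF that] algebra_simps)
    then show ?thesis by (simp only: w1[OF that] w2[OF that]) (simp add: algebra_simps)
  qed
  then have h: "g2 1 * g1 n - g1 1 * g2 n = 0" if "n \<ge> 1" for n
    by (rule formal_kernel_zero[OF _ _ that]) auto
  \<comment> \<open>On even blocks the second series vanishes and the first equals
    \<open>u k\<close>; the vanishing combination then identifies \<open>g2 1 * u k\<close> with a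
    fixed \<open>ell2\<close> vector on infinitely many blocks.\<close>
  have "g2 1 = 0"
  proof (rule block_coefficient_zero[OF _ inf(1)])
    fix k n assume k: "k \<in> {k. even k}" "p k \<le> n" "n < q k"
    show "coord (cscale (g2 1) w1 - cscale (g1 1) w2) n = g2 1 * coord (u k) n"
      using h[OF blocks(3)[OF k(2,3)]] blocks[OF k(2,3)] k(1)
      by (simp add: g1_def g2_def algebra_simps)
  qed
  then have g2: "g2 n = 0" if "n \<ge> 1" for n
    using formal_kernel_zero[OF w2 _ that] by simp
  \<comment> \<open>Now \<open>g2\<close> vanishes, so the second series coincides with the
    \<open>ell2\<close> vector \<open>w2\<close> although it contains every odd block.\<close>
  have "(1 :: complex) = 0"
  proof (rule block_coefficient_zero[OF _ inf(2)])
    fix k n assume k: "k \<in> {k. odd k}" "p k \<le> n" "n < q k"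
    show "coord w2 n = 1 * coord (u k) n"
      using g2[OF blocks(3)[OF k(2,3)]] blocks[OF k(2,3)] k(1) by (simp add: g2_def)
  qed
  then show False by simp
qed

end

lemma weyl_imp_not_fredholm:
  assumes "weyl z"
  shows "\<not> fredholm {1..} (shift_op (jacobi {1..} a b) z)"
proof -
  let ?P = "\<lambda>k (u, p, q). norm u = 1 \<and> norm (shifted z u) \<le> (1 / 2) ^ k \<and>
    (\<forall>n. coord u n \<noteq> 0 \<longrightarrow> p \<le> n \<and> n < q) \<and> p \<ge> Suc k"
  \<comment> \<open>The parameter \<open>N\<close> places each new vector beyond the support of its
    predecessor; starting no earlier than \<open>Suc k\<close> is what keeps the formal series
    finite in each entry.\<close>
  have ex: "\<exists>u p q. ?P k (u, p, q) \<and> N \<le> p" for k N :: nat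
  proof -
    obtain v where v: "finite {n. coord v n \<noteq> 0}" "\<forall>n<max N (Suc k). coord v n = 0"
      "norm (shifted z v) < (1 / 2) ^ k * norm v"
      using assms unfolding weyl_def by (metis half_gt_zero zero_less_one zero_less_power)
    have "norm v > 0" using v(3) by (cases "v = 0") auto
    obtain q where q: "{n. coord v n \<noteq> 0} \<subseteq> {..<q}"
      using v(1) finite_nat_iff_bounded by blast
    show ?thesis
    proof (intro exI conjI)
      show "?P k (v /\<^sub>R norm v, max N (Suc k), q)"
        using v q \<open>norm v > 0\<close> by (auto simp: shifted.scaleR field_simps not_less[symmetric])
    qed simp
  qed
  have "\<exists>f. \<forall>k. ?P k (f k) \<and> snd (snd (f k)) \<le> fst (snd (f (Suc k)))"
  proof (rule dependent_nat_choice)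
    show "\<exists>x. ?P 0 x" using ex[of 0 0] by blast
    show "\<exists>y. ?P (Suc k) y \<and> snd (snd x) \<le> fst (snd y)" for x k
    proof -
      obtain u p q where "?P (Suc k) (u, p, q)" "snd (snd x) \<le> p"
        using ex[of "Suc k" "snd (snd x)"] by blast
      then show ?thesis by (intro exI[of _ "(u, p, q)"]) simp
    qed
  qed
  then obtain f where f: "\<forall>k. ?P k (f k) \<and> snd (snd (f k)) \<le> fst (snd (f (Suc k)))"
    by (elim exE)
  have "\<not> ell2_closed {1..} (shift_op (jacobi {1..} a b) z ` ell2 {1..})"
    by (rule not_closed_range[of "\<lambda>k. fst (f k)" z "\<lambda>k. fst (snd (f k))" "\<lambda>k. snd (snd (f k))"])
      (use f in \<open>auto simp: case_prod_beta\<close>)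
  then show ?thesis by (simp add: fredholm_def)
qed

end

subsection \<open>A priori bounds and the Fredholm property\<close>

context half_line_jacobi
begin

text \<open>The negated Weyl condition concerns finite supports only, but any violating vector would
  have a violating truncation.\<close>

lemma not_weyl_bounded_below:
  assumes "\<not> weyl z"
  obtains e N where "e > 0" "\<And>u. (\<And>n. n < N \<Longrightarrow> coord u n = 0) \<Longrightarrow> e * norm u \<le> norm (shifted z u)"
proof -
  obtain e N where e: "e > 0"
    and lower: "\<And>u. finite {n. coord u n \<noteq> 0} \<Longrightarrow> \<forall>n<N. coord u n = 0 \<Longrightarrow> e * norm u \<le> norm (shifted z u)"
    using assms unfolding weyl_def by (meson not_le)
  have "e * norm u \<le> norm (shifted z u)" if u: "\<And>n. n < N \<Longrightarrow> coord u n = 0" for u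
  proof (rule ccontr)
    assume "\<not> ?thesis"
    then obtain F where F: "finite F" "norm (shifted z (trunc F u)) < e * norm (trunc F u)"
      using ex_finite_trunc_small[OF bounded_linear_shifted, of z u e] by auto
    have "{n. coord (trunc F u) n \<noteq> 0} \<subseteq> F" by (auto simp: coord_trunc split: if_splits)
    then have "e * norm (trunc F u) \<le> norm (shifted z (trunc F u))"
      using F(1) u by (intro lower) (auto simp: coord_trunc dest: finite_subset)
    with F(2) show False by simp
  qed
  with e show thesis by (rule that)
qed

lemma not_weyl_apriori:
  assumes "\<not> weyl z"
  obtains K N where "K > 0" "\<And>u. norm u \<le> K * (norm (shifted z u) + norm (trunc {..<N} u))"
proof -
  obtain e N where e: "e > 0"
    and lower: "\<And>u. (\<And>n. n < N \<Longrightarrow> coord u n = 0) \<Longrightarrow> e * norm u \<le> norm (shifted z u)"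
    using not_weyl_bounded_below[OF assms] by blast
  obtain C where C: "C > 0" "\<And>u. norm (shifted z u) \<le> norm u * C"
    using shifted.pos_bounded by blast
  \<comment> \<open>The tail of \<open>u\<close> costs \<open>1 / e\<close>, moving the image of the
    head across costs \<open>C / e\<close>, and the head itself costs 1.\<close>
  define K where "K = 1 / e + C / e + 1"
  have "norm u \<le> K * (norm (shifted z u) + norm (trunc {..<N} u))" for u
  proof -
    let ?u1 = "trunc {..<N} u" and ?u2 = "trunc (- {..<N}) u"
    have "e * norm ?u2 \<le> norm (shifted z ?u2)"
      by (rule lower) (simp add: coord_trunc)
    also have "shifted z ?u2 = shifted z u - shifted z ?u1"
      using trunc_compl[of u "{..<N}"] by (simp add: add_diff_cancel_left' flip: shifted.diff)
         (metis add_diff_cancel_left')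
    also have "norm (shifted z u - shifted z ?u1) \<le> norm (shifted z u) + norm ?u1 * C"
      using norm_triangle_ineq4 C(2)[of ?u1] by (rule order_trans[OF _ add_left_mono])
    finally have "norm ?u2 \<le> norm (shifted z u) / e + norm ?u1 * C / e"
      using e by (simp add: field_simps)
    moreover have "norm u \<le> norm ?u1 + norm ?u2"
      using norm_triangle_ineq[of ?u1 ?u2] trunc_compl[of u "{..<N}"] by simp
    moreover have "0 \<le> norm (shifted z u) * (C / e + 1) + norm ?u1 * (1 / e)"
      using e C by simp
    ultimately show ?thesis
      by (simp add: K_def algebra_simps)
  qed
  moreover have "K > 0" using e C(1) by (simp add: K_def add_pos_pos)
  ultimately show thesis using that by blast
qed

text \<open>The form of this operator is the sum of the squares of \<open>norm (shifted z u)\<close>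
  and \<open>norm (trunc {..<N} u)\<close>, by normality; the a priori bound makes it coercive.
  Hence the range of \<open>shifted z\<close> and finitely many coordinates together span
  everything.\<close>

lemma not_weyl_solvable:
  assumes "\<not> weyl z"
  obtains N where "\<And>v. \<exists>y. v = shifted z (shifted (cnj z) y) + trunc {..<N} y"
proof -
  obtain K N where K: "K > 0" "\<And>u. norm u \<le> K * (norm (shifted z u) + norm (trunc {..<N} u))"
    using not_weyl_apriori[OF assms] by blast
  have "surj (\<lambda>y. shifted z (shifted (cnj z) y) + trunc {..<N} y)"
  proof (rule coercive_surj)
    show "bounded_linear (\<lambda>y. shifted z (shifted (cnj z) y) + trunc {..<N} y)"
      by (intro bounded_linear_add bounded_linear_trunc
          bounded_linear_compose[OF bounded_linear_shifted bounded_linear_shifted])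
    \<comment> \<open>The factor 2 comes from bounding the square of a sum by twice the sum of
      squares.\<close>
    show "1 / (2 * K\<^sup>2) > 0" using K(1) by simp
    show "1 / (2 * K\<^sup>2) * (norm u)\<^sup>2 \<le> (shifted z (shifted (cnj z) u) + trunc {..<N} u) \<bullet> u" for u
    proof -
      let ?x = "norm (shifted z u)" and ?y = "norm (trunc {..<N} u)"
      have "(norm u)\<^sup>2 \<le> (K * (?x + ?y))\<^sup>2"
        using K(2)[of u] by (intro power_mono) auto
      also have "\<dots> = K\<^sup>2 * (?x + ?y)\<^sup>2" by (simp add: power_mult_distrib)
      also have "\<dots> \<le> K\<^sup>2 * (2 * (?x\<^sup>2 + ?y\<^sup>2))"
        using sum_squares_bound[of ?x ?y] by (intro mult_left_mono) (auto simp: power2_sum)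
      finally have "1 / (2 * K\<^sup>2) * (norm u)\<^sup>2 \<le> ?x\<^sup>2 + ?y\<^sup>2"
        using K(1) by (simp add: field_simps)
      also have "?x\<^sup>2 = shifted z (shifted (cnj z) u) \<bullet> u"
        by (simp add: shifted.adjoint power2_norm_eq_inner[symmetric] shifted.norm_adjoint_eq)
      also have "?y\<^sup>2 = trunc {..<N} u \<bullet> u"
        by (simp add: norm_trunc_sq inner_commute)
      finally show ?thesis by (simp add: inner_add_left)
    qed
  qed
  then show thesis using that[of N] by (simp add: surj_def)
qed

text \<open>
  By the recursion \<open>a\<^sub>n u\<^sub>n\<^sub>+\<^sub>1 = \<dots>\<close>, convergence of \<open>(J - z) (y k)\<close> and of the first entry of \<open>y k\<close>
  forces convergence of every entry, and the a priori bound turns this into norm convergence.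
\<close>

lemma limit_in_range:
  assumes "\<not> weyl z" and y0: "\<And>k. coord (y k) 0 = 0"
    and v: "(\<lambda>k. shifted z (y k)) \<longlonglongrightarrow> v" and t: "(\<lambda>k. coord (y k) 1) \<longlonglongrightarrow> t"
  obtains u where "shifted z u = v" "coord u 0 = 0" "coord u 1 = t"
proof -
  obtain K N where K: "K > 0" "\<And>u. norm u \<le> K * (norm (shifted z u) + norm (trunc {..<N} u))"
    using not_weyl_apriori[OF assms(1)] by blast
  have "convergent (\<lambda>k. coord (y k) n)" for n
  proof (induction n rule: less_induct)
    case (less n)
    consider "n = 0" | "n = 1" | m where "n = Suc m" "m \<ge> 1"
      by (cases n; cases "n = 1") auto
    then show ?case
    proof cases
      case (3 m)
      have rec: "coord (y k) n = (coord (shifted z (y k)) m + z * coord (y k) m - b m * coord (y k) m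
          - (if m \<ge> 2 then a (m - 1) else 0) * coord (y k) (m - 1)) / a m" for k
        using coord_shifted[OF 3(2), of z "y k"] a_pos[OF 3(2)] 3 by (simp add: field_simps)
      have "convergent (\<lambda>k. coord (shifted z (y k)) m)"
        using tendsto_coord[OF v] by (auto simp: convergent_def)
      moreover have "convergent (\<lambda>k. coord (y k) m)" "convergent (\<lambda>k. coord (y k) (m - 1))"
        using less 3 by auto
      ultimately show ?thesis
        unfolding rec by (intro convergent_diff convergent_add convergent_mult convergent_const
            bounded_linear.convergent[OF bounded_linear_divide])
    qed (use t y0 in \<open>auto simp: convergent_def\<close>)
  qed
  then obtain x where x: "\<And>n. (\<lambda>k. coord (y k) n) \<longlonglongrightarrow> x n"
    unfolding convergent_def by metis
  \<comment> \<open>Only the entries of \<open>x\<close> below \<open>N\<close> occur, so nothing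
    has to be known yet about square summability of \<open>x\<close>.\<close>
  define r where "r k = K * (norm (shifted z (y k) - v) + (\<Sum>i<N. cmod (coord (y k) i - x i)))" for k
  have "r \<longlonglongrightarrow> K * (norm (v - v) + (\<Sum>i<N. cmod (x i - x i)))"
    unfolding r_def by (intro tendsto_intros v x)
  then have r: "r \<longlonglongrightarrow> 0" by simp
  have le: "norm (y k - y l) \<le> r k + r l" for k l
  proof -
    have 1: "norm (shifted z (y k) - shifted z (y l)) \<le> norm (shifted z (y k) - v) + norm (shifted z (y l) - v)"
      using norm_triangle_ineq4[of "shifted z (y k) - v" "shifted z (y l) - v"] by simp
    have "norm (trunc {..<N} (y k - y l)) \<le> (\<Sum>i<N. cmod (coord (y k) i - coord (y l) i))"
      using norm_trunc_le_sum[of "{..<N}" "y k - y l"] by simp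
    also have "\<dots> \<le> (\<Sum>i<N. cmod (coord (y k) i - x i) + cmod (coord (y l) i - x i))"
      by (intro sum_mono) (metis dist_norm dist_triangle2)
    finally have 2: "norm (trunc {..<N} (y k - y l)) \<le> (\<Sum>i<N. cmod (coord (y k) i - x i)) + (\<Sum>i<N. cmod (coord (y l) i - x i))"
      by (simp add: sum.distrib)
    have "norm (y k - y l) \<le> K * (norm (shifted z (y k - y l)) + norm (trunc {..<N} (y k - y l)))"
      by (rule K(2))
    also have "\<dots> \<le> r k + r l"
      unfolding r_def distrib_left[symmetric] using 1 2 K(1)
      by (intro mult_left_mono) (auto simp: shifted.diff)
    finally show ?thesis .
  qed
  have "Cauchy y"
  proof (rule CauchyI)
    fix e :: real assume "e > 0"
    then have "\<forall>\<^sub>F k in sequentially. r k < e / 2"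
      by (intro order_tendstoD(2)[OF r]) simp
    then obtain k0 where "\<And>k. k \<ge> k0 \<Longrightarrow> r k < e / 2"
      by (auto simp: eventually_sequentially)
    then show "\<exists>k0. \<forall>k\<ge>k0. \<forall>l\<ge>k0. norm (y k - y l) < e"
      using le by (intro exI[of _ k0] allI impI) (smt (verit) field_sum_of_halves)
  qed
  then obtain u where u: "y \<longlonglongrightarrow> u"
    using convergent_eq_Cauchy by blast
  show thesis
  proof (rule that)
    show "shifted z u = v"
      using LIMSEQ_unique shifted.tendsto[OF u] v by blast
    show "coord u 0 = 0"
      using LIMSEQ_unique[OF tendsto_coord[OF u, of 0]] by (simp add: y0)
    show "coord u 1 = t"
      using LIMSEQ_unique[OF tendsto_coord[OF u] t] .
  qed
qed

text \<open>Otherwise division by an unbounded first entry sends the images to zero, and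
  \<open>limit_in_range\<close> produces a kernel vector with first entry 1.\<close>

lemma bounded_first_entry:
  assumes "\<not> weyl z" and y0: "\<And>k. coord (y k) 0 = 0"
    and v: "(\<lambda>k. shifted z (y k)) \<longlonglongrightarrow> v"
    and no_kernel: "\<And>u. shifted z u = 0 \<Longrightarrow> coord u 0 = 0 \<Longrightarrow> u = 0"
  shows "bounded (range (\<lambda>k. coord (y k) 1))"
proof (rule ccontr)
  assume "\<not> ?thesis"
  then have "\<exists>k. cmod (coord (y k) 1) > real j + 1" for j
    unfolding bounded_iff by (auto simp: not_le)
  then obtain k where k: "\<And>j. cmod (coord (y (k j)) 1) > real j + 1" by metis
  define w where "w j = cscale (1 / coord (y (k j)) 1) (y (k j))" for j
  have "bounded (range (\<lambda>k. shifted z (y k)))"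
    using v by (rule convergent_imp_bounded)
  then obtain C where C: "\<And>k. norm (shifted z (y k)) \<le> C"
    unfolding bounded_iff by blast
  have "(\<lambda>j. shifted z (w j)) \<longlonglongrightarrow> 0"
  proof (rule Lim_null_comparison)
    show "(\<lambda>j. C * inverse (real (Suc j))) \<longlonglongrightarrow> 0"
      using tendsto_mult[OF tendsto_const[of C] LIMSEQ_inverse_real_of_nat] by simp
    show "\<forall>\<^sub>F j in sequentially. norm (shifted z (w j)) \<le> C * inverse (real (Suc j))"
    proof (intro always_eventually allI)
      fix j
      have "norm (shifted z (w j)) = norm (shifted z (y (k j))) * inverse (cmod (coord (y (k j)) 1))"
        by (simp add: w_def shifted_cscale norm_divide norm_inverse divide_inverse mult.commute)
      also have "\<dots> \<le> C * inverse (real (Suc j))"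
        using k[of j] C[of "k j"] order_trans[OF norm_ge_zero C]
        by (intro mult_mono le_imp_inverse_le) auto
      finally show "norm (shifted z (w j)) \<le> C * inverse (real (Suc j))" .
    qed
  qed
  moreover have "coord (w j) 1 = 1" for j
    using k[of j] by (auto simp: w_def)
  then have "(\<lambda>j. coord (w j) 1) \<longlonglongrightarrow> 1" by simp
  ultimately obtain u where "shifted z u = 0" "coord u 0 = 0" "coord u 1 = 1"
    using limit_in_range[OF assms(1), of w 0 1] by (auto simp: w_def y0)
  with no_kernel[of u] show False by auto
qed

lemma not_weyl_closed_range:
  assumes "\<not> weyl z"
  shows "ell2_closed {1..} (shift_op (jacobi {1..} a b) z ` ell2 {1..})"
  unfolding ell2_closed_def
proof (intro allI impI, elim conjE)
  fix s v'
  assume s: "\<forall>k. s k \<in> shift_op (jacobi {1..} a b) z ` ell2 {1..}" and "v' \<in> ell2 {1..}"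
    and lim: "(\<lambda>k. ell2_norm {1..} (\<lambda>i. s k i - v' i)) \<longlonglongrightarrow> 0"
  obtain v where v: "v' = coord v" "coord v 0 = 0"
    using \<open>v' \<in> ell2 {1..}\<close> ell2_half by blast
  have range: "x \<in> shift_op (jacobi {1..} a b) z ` ell2 {1..} \<longleftrightarrow>
      (\<exists>u. x = coord (shifted z u) \<and> coord u 0 = 0)" for x
    unfolding shift_op_coord[symmetric] image_iff Bex_def ell2_half by blast
  have "\<exists>y. s k = coord (shifted z y) \<and> coord y 0 = 0" for k
    using s range by blast
  then obtain y where y: "\<And>k. s k = coord (shifted z (y k))" and y0: "\<And>k. coord (y k) 0 = 0"
    by metis
  have "ell2_norm {1..} (\<lambda>i. s k i - v' i) = norm (shifted z (y k) - v)" for k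
    using ell2_norm_half[of "shifted z (y k) - v"] by (simp add: y y0 v coord_shifted_0)
  then have y_lim: "(\<lambda>k. shifted z (y k)) \<longlonglongrightarrow> v"
    using lim by (simp add: tendsto_norm_zero_iff flip: LIM_zero_iff[of _ v])
  \<comment> \<open>Convergence of the first entries has to be arranged: a kernel vector allows
    normalising them to 0; without one they are bounded and a subsequence converges.\<close>
  have "\<exists>u. shifted z u = v \<and> coord u 0 = 0"
  proof (cases "\<exists>p. shifted z p = 0 \<and> coord p 0 = 0 \<and> p \<noteq> 0")
    case True
    then obtain p where p: "shifted z p = 0" "coord p 0 = 0" "coord p 1 \<noteq> 0"
      using kernel_zero by blast
    define w where "w k = y k - cscale (coord (y k) 1 / coord p 1) p" for k
    have "shifted z (w k) = shifted z (y k)" "coord (w k) 0 = 0" "coord (w k) 1 = 0" for k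
      using p y0 by (auto simp: w_def shifted.diff shifted_cscale intro!: l2_eqI)
    with y_lim limit_in_range[OF assms, of w v 0] show ?thesis by auto
  next
    case False
    then have "bounded (range (\<lambda>k. coord (y k) 1))"
      using bounded_first_entry[OF assms y0 y_lim] by blast
    then obtain t r where r: "strict_mono r" "((\<lambda>k. coord (y k) 1) \<circ> r) \<longlonglongrightarrow> t"
      using bounded_imp_convergent_subsequence by blast
    have "((\<lambda>k. shifted z (y k)) \<circ> r) \<longlonglongrightarrow> v"
      using LIMSEQ_subseq_LIMSEQ[OF y_lim r(1)] .
    with r limit_in_range[OF assms, of "y \<circ> r" v t] show ?thesis by (auto simp: o_def y0)
  qed
  then show "v' \<in> shift_op (jacobi {1..} a b) z ` ell2 {1..}"
    unfolding v(1) range by blast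
qed

text \<open>By the recursion the first entry determines a kernel vector, so one spanning vector
  suffices, at every \<open>z\<close>.\<close>

lemma kernel_finite_dim:
  "\<exists>B. finite B \<and> B \<subseteq> ell2 {1..} \<and>
     (\<forall>x\<in>ell2 {1..}. shift_op (jacobi {1..} a b) z x = (\<lambda>i. 0) \<longrightarrow> (\<exists>c. x = (\<lambda>i. \<Sum>w\<in>B. c w * w i)))"
proof -
  have zero: "shift_op (jacobi {1..} a b) z (coord u) = (\<lambda>i. 0) \<longleftrightarrow> shifted z u = 0" for u
    unfolding shift_op_coord by (auto intro: l2_eqI)
  show ?thesis
  proof (cases "\<exists>p. shifted z p = 0 \<and> coord p 0 = 0 \<and> p \<noteq> 0")
    case True
    then obtain p where p: "shifted z p = 0" "coord p 0 = 0" "coord p 1 \<noteq> 0"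
      using kernel_zero by blast
    have "coord u = (\<lambda>i. coord u 1 / coord p 1 * coord p i)" if u: "shifted z u = 0" "coord u 0 = 0" for u
    proof -
      have "u - cscale (coord u 1 / coord p 1) p = 0"
        by (rule kernel_zero[of z]) (use u p in \<open>auto simp: shifted.diff shifted_cscale intro!: l2_eqI\<close>)
      then have "u = cscale (coord u 1 / coord p 1) p" by simp
      then show ?thesis by (metis coord_cscale)
    qed
    then have "\<exists>c. coord u = (\<lambda>i. c (coord p) * coord p i)" if "shifted z u = 0" "coord u 0 = 0" for u
      using that by (intro exI[of _ "\<lambda>_. coord u 1 / coord p 1"]) blast
    then show ?thesis
      using p(2) by (intro exI[of _ "{coord p}"]) (auto simp: ell2_half zero)
  next
    case False
    then have "coord u = (\<lambda>i. 0)" if "shifted z u = 0" "coord u 0 = 0" for u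
      using that by (metis zero_l2.rep_eq)
    then show ?thesis
      by (intro exI[of _ "{}"]) (auto simp: ell2_half zero)
  qed
qed

lemma cokernel_finite_dim:
  assumes "\<not> weyl z"
  shows "\<exists>B. finite B \<and> B \<subseteq> ell2 {1..} \<and>
     (\<forall>v\<in>ell2 {1..}. \<exists>x\<in>ell2 {1..}. \<exists>c. v = (\<lambda>i. shift_op (jacobi {1..} a b) z x i + (\<Sum>w\<in>B. c w * w i)))"
proof -
  obtain N where N: "\<And>v. \<exists>y. v = shifted z (shifted (cnj z) y) + trunc {..<N} y"
    using not_weyl_solvable[OF assms] by blast
  define d :: "nat \<Rightarrow> nat \<Rightarrow> complex" where "d j i = of_bool (i = j)" for i j
  have inj: "inj_on d {1..<N}" by (auto simp: inj_on_def d_def fun_eq_iff)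
  have d: "d j \<in> ell2 {1..}" if "j \<ge> 1" for j
  proof -
    have "(\<lambda>i. (cmod (d j i))\<^sup>2) summable_on {1..} \<longleftrightarrow> (\<lambda>i. (cmod (d j i))\<^sup>2) summable_on {j}"
      by (rule summable_on_cong_neutral) (use that in \<open>auto simp: d_def\<close>)
    then have "(\<lambda>i. (cmod (d j i))\<^sup>2) summable_on {1..}" by simp
    moreover have "d j i = 0" if "i \<notin> {1..}" for i
      using that \<open>j \<ge> 1\<close> by (auto simp: d_def)
    ultimately show ?thesis by (simp add: ell2_def)
  qed
  have "\<exists>x\<in>ell2 {1..}. \<exists>c. v = (\<lambda>i. shift_op (jacobi {1..} a b) z x i + (\<Sum>w\<in>d ` {1..<N}. c w * w i))"
    if "v \<in> ell2 {1..}" for v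
  proof -
    obtain v' where v': "v = coord v'" "coord v' 0 = 0" using \<open>v \<in> ell2 {1..}\<close> ell2_half by blast
    obtain y where y: "v' = shifted z (shifted (cnj z) y) + trunc {..<N} y" using N by blast
    \<comment> \<open>Removing the spurious coordinate 0 does not change the rows from 1 on.\<close>
    define w where "w = trunc {1..} (shifted (cnj z) y)"
    \<comment> \<open>Coefficients are indexed by the spanning vectors themselves, so the position
      has to be recovered from the unit vector.\<close>
    define c where "c f = coord y (inv_into {1..<N} d f)" for f
    have sum: "(\<Sum>f\<in>d ` {1..<N}. c f * f i) = (if i \<in> {1..<N} then coord y i else 0)" for i
    proof -
      have "(\<Sum>f\<in>d ` {1..<N}. c f * f i) = (\<Sum>j\<in>{1..<N}. coord y j * d j i)"
        using inj by (simp add: sum.reindex c_def)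
      also have "\<dots> = (\<Sum>j\<in>{1..<N}. if i = j then coord y j else 0)"
        by (intro sum.cong) (auto simp: d_def)
      finally show ?thesis by simp
    qed
    have "coord v' i = coord (shifted z w) i + (\<Sum>f\<in>d ` {1..<N}. c f * f i)" for i
    proof (cases "i \<ge> 1")
      case True
      then have "coord (shifted z w) i = coord (shifted z (shifted (cnj z) y)) i"
        unfolding coord_shifted[OF True, of z] by (auto simp: w_def coord_trunc)
      with True show ?thesis unfolding sum by (simp add: y coord_trunc)
    next
      case False
      then have "i = 0" by simp
      then show ?thesis unfolding sum by (simp add: v'(2) coord_shifted_0 w_def coord_trunc)
    qed
    then have "v = (\<lambda>i. shift_op (jacobi {1..} a b) z (coord w) i + (\<Sum>f\<in>d ` {1..<N}. c f * f i))"
      unfolding v'(1) shift_op_coord by blast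
    moreover have "coord w 0 = 0" by (simp add: w_def coord_trunc)
    then have "coord w \<in> ell2 {1..}" using ell2_half by blast
    ultimately show ?thesis by blast
  qed
  then show ?thesis
    using d by (intro exI[of _ "d ` {1..<N}"]) auto
qed

theorem ess_spectrum_iff_weyl: "z \<in> ess_spectrum {1..} (jacobi {1..} a b) \<longleftrightarrow> weyl z"
proof -
  have "fredholm {1..} (shift_op (jacobi {1..} a b) z)" if "\<not> weyl z"
    unfolding fredholm_def
    by (intro conjI kernel_finite_dim not_weyl_closed_range[OF that] cokernel_finite_dim[OF that])
  then show ?thesis
    using weyl_imp_not_fredholm[of z] by (auto simp: ess_spectrum_def)
qed

end

subsection \<open>Right limits have singular Weyl sequences\<close>

text \<open>Tychonoff's theorem replaces a diagonal argument; over a countable index type the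
  product is metrizable, so compactness provides subsequences.\<close>

lemma pointwise_convergent_subsequence:
  fixes x :: "nat \<Rightarrow> 'i::countable \<Rightarrow> 'b::heine_borel"
  assumes "bounded S" "\<And>k i. x k i \<in> S"
  obtains g r where "strict_mono r" "\<And>i. (\<lambda>k. x (r k) i) \<longlonglongrightarrow> g i"
proof -
  let ?C = "PiE UNIV (\<lambda>_ :: 'i. closure S)"
  have "compactin (product_topology (\<lambda>_. euclidean) UNIV) ?C"
    using assms(1) by (simp add: compactin_PiE compact_closure)
  then have "compact ?C"
    by (simp add: euclidean_product_topology)
  then have "seq_compact ?C"
    by (simp add: compact_eq_seq_compact_metric)
  moreover have "x k \<in> ?C" for k
    using assms(2) closure_subset by (auto simp: PiE_UNIV_domain)
  ultimately obtain g r where "strict_mono r" and lim: "(x \<circ> r) \<longlonglongrightarrow> g"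
    unfolding seq_compact_def by metis
  have "(\<lambda>k. x (r k) i) \<longlonglongrightarrow> g i" for i
  proof -
    have "continuous_on UNIV (\<lambda>f :: 'i \<Rightarrow> 'b. f i)"
      by (rule continuous_on_product_coordinates)
    from continuous_on_tendsto_compose[OF this lim] show ?thesis by (simp add: o_def)
  qed
  with \<open>strict_mono r\<close> show thesis by (rule that)
qed

text \<open>Window positions tend to infinity but may repeat, whereas \<open>right_limits\<close>
  asks for strictly increasing ones. Choosing each index beyond the previous value of
  \<open>f\<close> suffices.\<close>

lemma ex_strict_mono_subsequence:
  fixes f :: "nat \<Rightarrow> nat"
  assumes "\<And>k. k \<le> f k"
  shows "\<exists>s :: nat \<Rightarrow> nat. strict_mono s \<and> strict_mono (\<lambda>k. f (s k))"
proof -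
  define s where "s = rec_nat 0 (\<lambda>_ m. Suc (f m))"
  have s: "s (Suc n) = Suc (f (s n))" for n by (simp add: s_def)
  have "strict_mono s"
    unfolding strict_mono_Suc_iff s using assms by (simp add: le_imp_less_Suc)
  moreover have "strict_mono (\<lambda>k. f (s k))"
    unfolding strict_mono_Suc_iff
  proof
    show "f (s n) < f (s (Suc n))" for n
      using assms[of "s (Suc n)"] by (simp add: s)
  qed
  ultimately show ?thesis by blast
qed

text \<open>The squared norm of \<open>(J - z) g\<close> for \<open>g\<close> supported inside the
  window, written as a finite sum in the coefficients. One formula thus serves line and half-line
  and passes to entrywise limits.\<close>

definition window_energy ::
    "int \<Rightarrow> complex \<Rightarrow> (int \<Rightarrow> real) \<Rightarrow> (int \<Rightarrow> real) \<Rightarrow> (int \<Rightarrow> complex) \<Rightarrow> real" where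
  "window_energy K z \<alpha> \<beta> g = (\<Sum>l\<in>{- K..K}. (cmod (\<alpha> l * g (l + 1) + \<beta> l * g l
     + \<alpha> (l - 1) * g (l - 1) - z * g l))\<^sup>2)"

lemma tendsto_window_energy:
  assumes "\<And>l. (\<lambda>j. \<alpha> j l) \<longlonglongrightarrow> \<alpha>' l" "\<And>l. (\<lambda>j. \<beta> j l) \<longlonglongrightarrow> \<beta>' l" "\<And>l. (\<lambda>j. g j l) \<longlonglongrightarrow> g' l"
  shows "(\<lambda>j. window_energy K z (\<alpha> j) (\<beta> j) (g j)) \<longlonglongrightarrow> window_energy K z \<alpha>' \<beta>' g'"
  unfolding window_energy_def by (intro tendsto_intros assms)

section \<open>Window formulas on the line and on the half-line\<close>

locale line_jacobi =
  fixes a b :: "int \<Rightarrow> real" and M :: real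
  assumes a_bound: "\<bar>a l\<bar> \<le> M" and b_bound: "\<bar>b l\<bar> \<le> M"
begin

sublocale symmetric_op "jac_op UNIV a b"
  by (rule symmetric_op_jac_int[OF a_bound b_bound])

lemma spectrum_iff: "z \<in> spectrum UNIV (jacobi UNIV a b) \<longleftrightarrow> \<not> bounded_below z"
  by (rule spectrum_iff_not_bounded_below) (rule coord_jac_op_int[OF a_bound b_bound])

lemma coord_shifted:
  "coord (shifted z u) l = a l * coord u (l + 1) + b l * coord u l + a (l - 1) * coord u (l - 1) - z * coord u l"
  by (simp add: shifted_def coord_jac_op_int[OF a_bound b_bound] jacobi_int)

lemma norm_shifted_window:
  assumes "\<And>l. coord u l \<noteq> 0 \<Longrightarrow> \<bar>l\<bar> < K"
  shows "(norm (shifted z u))\<^sup>2 = window_energy K z a b (coord u)"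
proof -
  have z: "coord u l = 0" if "\<bar>l\<bar> \<ge> K" for l
    using assms[of l] that by auto
  have "(norm (shifted z u))\<^sup>2 = (\<Sum>l\<in>{- K..K}. (cmod (coord (shifted z u) l))\<^sup>2)"
    by (rule norm_l2_sq_finite) (auto simp: coord_shifted z)
  then show ?thesis by (simp add: coord_shifted window_energy_def)
qed

lemma norm_window:
  fixes u :: "int l2"
  assumes "\<And>l. coord u l \<noteq> 0 \<Longrightarrow> \<bar>l\<bar> < K"
  shows "(norm u)\<^sup>2 = (\<Sum>l\<in>{- K..K}. (cmod (coord u l))\<^sup>2)"
proof (rule norm_l2_sq_finite)
  have "l \<in> {- K..K}" if "coord u l \<noteq> 0" for l
    using assms[OF that] unfolding atLeastAtMost_iff by linarith
  then show "coord u l = 0" if "l \<notin> {- K..K}" for l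
    using that by blast
qed simp

end

lemma norm_l2_sq_window:
  fixes u :: "nat l2"
  assumes "\<And>n. coord u n \<noteq> 0 \<Longrightarrow> \<bar>int n - int c\<bar> \<le> K" and "K \<le> int c"
  shows "(norm u)\<^sup>2 = (\<Sum>l\<in>{- K..K}. (cmod (coord u (nat (int c + l))))\<^sup>2)"
proof -
  have inj: "inj_on (\<lambda>l. nat (int c + l)) {- K..K}"
    using assms(2) by (auto simp: inj_on_def)
  have "(norm u)\<^sup>2 = (\<Sum>n\<in>(\<lambda>l. nat (int c + l)) ` {- K..K}. (cmod (coord u n))\<^sup>2)"
  proof (rule norm_l2_sq_finite)
    fix n assume n: "n \<notin> (\<lambda>l. nat (int c + l)) ` {- K..K}"
    show "coord u n = 0"
    proof (rule ccontr)
      assume "coord u n \<noteq> 0"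
      then have "\<bar>int n - int c\<bar> \<le> K" by (rule assms(1))
      then have "n = nat (int c + (int n - int c))" "int n - int c \<in> {- K..K}" by auto
      with n show False by blast
    qed
  qed simp
  then show ?thesis using inj by (simp add: sum.reindex)
qed

context half_line_jacobi
begin

text \<open>The strict support bound leaves room for the one-step spreading of a tridiagonal matrix.
  With \<open>K + 2 \<le> int c\<close> all rows concerned have index at least 2, where the boundary
  of the half-line is invisible.\<close>

lemma norm_shifted_window:
  assumes supp: "\<And>n. coord u n \<noteq> 0 \<Longrightarrow> \<bar>int n - int c\<bar> < K" and c: "K + 2 \<le> int c"
  shows "(norm (shifted z u))\<^sup>2 = window_energy K z (\<lambda>l. a (nat (int c + l))) (\<lambda>l. b (nat (int c + l)))
    (\<lambda>l. coord u (nat (int c + l)))"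
proof -
  have zero: "coord u n = 0" if "\<bar>int n - int c\<bar> \<ge> K" for n
    using supp[of n] that by auto
  have supp': "\<bar>int n - int c\<bar> \<le> K" if "coord (shifted z u) n \<noteq> 0" for n
  proof (rule ccontr)
    assume n: "\<not> ?thesis"
    have "coord u n = 0" "coord u (Suc n) = 0" using n by (auto intro!: zero)
    moreover have "n \<ge> 1 \<Longrightarrow> coord u (n - 1) = 0" using n by (intro zero) (auto simp: of_nat_diff)
    ultimately have "coord (shifted z u) n = 0"
      using coord_shifted[of n z u] coord_shifted_0[of z u] by (cases "n = 0") (auto simp: not_less_eq_eq)
    with that show False by simp
  qed
  have "(norm (shifted z u))\<^sup>2 = (\<Sum>l\<in>{- K..K}. (cmod (coord (shifted z u) (nat (int c + l))))\<^sup>2)"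
    using c by (intro norm_l2_sq_window supp') auto
  also have "\<dots> = window_energy K z (\<lambda>l. a (nat (int c + l))) (\<lambda>l. b (nat (int c + l)))
      (\<lambda>l. coord u (nat (int c + l)))"
    unfolding window_energy_def
  proof (rule sum.cong)
    fix l assume l: "l \<in> {- K..K}"
    have "nat (int c + l) \<ge> 2" "Suc (nat (int c + l)) = nat (int c + (l + 1))"
      "nat (int c + l) - 1 = nat (int c + (l - 1))"
      using l c by auto
    then show "(cmod (coord (shifted z u) (nat (int c + l))))\<^sup>2 =
        (cmod (a (nat (int c + l)) * coord u (nat (int c + (l + 1))) + b (nat (int c + l)) * coord u (nat (int c + l))
          + a (nat (int c + (l - 1))) * coord u (nat (int c + (l - 1))) - z * coord u (nat (int c + l))))\<^sup>2"
      using coord_shifted[of "nat (int c + l)" z u] by simp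
  qed simp
  finally show ?thesis .
qed

lemma right_limit_line_jacobi:
  assumes "(ar, br) \<in> right_limits a b"
  shows "line_jacobi ar br M"
proof -
  obtain N :: "nat \<Rightarrow> nat" where N: "strict_mono N"
    and lim: "\<And>l. (\<lambda>j. a (nat (int (N j) + l))) \<longlonglongrightarrow> ar l" "\<And>l. (\<lambda>j. b (nat (int (N j) + l))) \<longlonglongrightarrow> br l"
    using assms unfolding right_limits_def by auto
  \<comment> \<open>The bounds say nothing about index 0, which only finitely many \<open>j\<close>
    can produce.\<close>
  have ev: "\<forall>\<^sub>F j in sequentially. nat (int (N j) + l) \<ge> 1" for l
  proof (rule eventually_sequentiallyI)
    fix j assume "j \<ge> nat \<bar>l\<bar> + 1"
    moreover have "N j \<ge> j" using N by (rule seq_suble)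
    ultimately show "nat (int (N j) + l) \<ge> 1" by linarith
  qed
  show ?thesis
  proof
    fix l
    show "\<bar>ar l\<bar> \<le> M"
      by (rule tendsto_upperbound[OF tendsto_rabs[OF lim(1)]])
        (use ev[of l] in \<open>auto elim!: eventually_mono intro: a_bound\<close>)
    show "\<bar>br l\<bar> \<le> M"
      by (rule tendsto_upperbound[OF tendsto_rabs[OF lim(2)]])
        (use ev[of l] in \<open>auto elim!: eventually_mono intro: b_bound\<close>)
  qed
qed

lemma right_limit_spectrum_weyl:
  assumes R: "(ar, br) \<in> right_limits a b" and z: "z \<in> spectrum UNIV (jacobi UNIV ar br)"
  shows "weyl z"
  unfolding weyl_def
proof (intro allI impI)
  fix e :: real and N0 :: nat
  assume "e > 0"
  interpret R: line_jacobi ar br M using R by (rule right_limit_line_jacobi)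
  obtain N :: "nat \<Rightarrow> nat" where N: "strict_mono N"
    and lim: "\<And>l. (\<lambda>j. a (nat (int (N j) + l))) \<longlonglongrightarrow> ar l" "\<And>l. (\<lambda>j. b (nat (int (N j) + l))) \<longlonglongrightarrow> br l"
    using R unfolding right_limits_def by auto
  obtain u0 where "norm (R.shifted z u0) < e * norm u0"
    using z \<open>e > 0\<close> unfolding R.spectrum_iff R.bounded_below_def by (meson not_le)
  then obtain F where F: "finite F" "norm (R.shifted z (trunc F u0)) < e * norm (trunc F u0)"
    using ex_finite_trunc_small[OF R.bounded_linear_shifted] by blast
  define u where "u = trunc F u0"
  \<comment> \<open>Inserting 1 covers an empty \<open>F\<close>; the added 1 makes the support
    bound strict.\<close>
  define K where "K = Max (insert 1 (abs ` F)) + 1"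
  have supp: "\<bar>l\<bar> < K" if "coord u l \<noteq> 0" for l
  proof -
    have "l \<in> F" using that by (auto simp: u_def coord_trunc split: if_splits)
    then have "\<bar>l\<bar> \<le> Max (insert 1 (abs ` F))" using F(1) by (intro Max_ge) auto
    then show ?thesis by (simp add: K_def)
  qed
  define v where "v j = Abs_l2 (\<lambda>n. coord u (int n - int (N j)))" for j
  have v: "coord (v j) n = coord u (int n - int (N j))" for j n
  proof -
    have "(\<lambda>n. coord u (int n - int (N j))) \<in> ell2 UNIV"
    proof (rule ell2_UNIV_I)
      fix G :: "nat set" assume "finite G"
      have "(\<Sum>n\<in>G. (cmod (coord u (int n - int (N j))))\<^sup>2) =
          (\<Sum>l\<in>(\<lambda>n. int n - int (N j)) ` G. (cmod (coord u l))\<^sup>2)"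
        by (subst sum.reindex) (auto simp: inj_on_def)
      also have "\<dots> \<le> (norm u)\<^sup>2" using \<open>finite G\<close> by (intro sum_le_norm_l2_sq) simp
      finally show "(\<Sum>n\<in>G. (cmod (coord u (int n - int (N j))))\<^sup>2) \<le> (norm u)\<^sup>2" .
    qed
    then show ?thesis by (simp add: v_def)
  qed
  have v_supp: "\<bar>int n - int (N j)\<bar> < K" if "coord (v j) n \<noteq> 0" for n j
    using supp that by (simp add: v)
  \<comment> \<open>The vector stays fixed while only finitely many coefficients move, so the strict
    inequality for the limit holds eventually.\<close>
  have "(\<lambda>j. window_energy K z (\<lambda>l. a (nat (int (N j) + l))) (\<lambda>l. b (nat (int (N j) + l))) (coord u))
      \<longlonglongrightarrow> window_energy K z ar br (coord u)"
    by (intro tendsto_window_energy lim tendsto_const)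
  moreover have "(norm (R.shifted z u))\<^sup>2 = window_energy K z ar br (coord u)"
    by (rule R.norm_shifted_window) (rule supp)
  then have "window_energy K z ar br (coord u) < (e * norm u)\<^sup>2"
    using F(2) by (metis norm_ge_zero pos2 power_strict_mono u_def)
  ultimately have "\<forall>\<^sub>F j in sequentially. window_energy K z (\<lambda>l. a (nat (int (N j) + l)))
      (\<lambda>l. b (nat (int (N j) + l))) (coord u) < (e * norm u)\<^sup>2"
    by (rule order_tendstoD(2))
  \<comment> \<open>The summand \<open>nat K + 2\<close> fits the window into the half-line, and
    \<open>N0\<close> pushes the support beyond the prescribed index.\<close>
  moreover have "\<forall>\<^sub>F j in sequentially. j \<ge> nat K + 2 + N0" by (rule eventually_ge_at_top)
  ultimately have "\<forall>\<^sub>F j in sequentially. j \<ge> nat K + 2 + N0 \<and> window_energy K z (\<lambda>l. a (nat (int (N j) + l)))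
      (\<lambda>l. b (nat (int (N j) + l))) (coord u) < (e * norm u)\<^sup>2"
    by eventually_elim simp
  then obtain j where j: "j \<ge> nat K + 2 + N0" "window_energy K z (\<lambda>l. a (nat (int (N j) + l)))
      (\<lambda>l. b (nat (int (N j) + l))) (coord u) < (e * norm u)\<^sup>2"
    using eventually_happens'[OF sequentially_bot] by blast
  have Nj: "int (N j) \<ge> K + 2 + int N0"
    using j(1) seq_suble[OF N, of j] by linarith
  have shift: "coord (v j) (nat (int (N j) + l)) = coord u l" if "\<bar>l\<bar> \<le> K + 1" for l
  proof -
    have "0 \<le> int (N j) + l" using that Nj by linarith
    then show ?thesis by (simp add: v)
  qed
  have "(norm (shifted z (v j)))\<^sup>2 = window_energy K z (\<lambda>l. a (nat (int (N j) + l)))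
      (\<lambda>l. b (nat (int (N j) + l))) (\<lambda>l. coord (v j) (nat (int (N j) + l)))"
    using Nj by (intro norm_shifted_window v_supp) auto
  also have "\<dots> = window_energy K z (\<lambda>l. a (nat (int (N j) + l))) (\<lambda>l. b (nat (int (N j) + l))) (coord u)"
    unfolding window_energy_def by (intro sum.cong) (auto simp: shift)
  also have "\<dots> < (e * norm u)\<^sup>2" by (rule j(2))
  also have "norm u = norm (v j)"
  proof -
    have "(norm (v j))\<^sup>2 = (\<Sum>l\<in>{- K..K}. (cmod (coord (v j) (nat (int (N j) + l))))\<^sup>2)"
      using Nj v_supp by (intro norm_l2_sq_window) (auto intro: less_imp_le)
    also have "\<dots> = (\<Sum>l\<in>{- K..K}. (cmod (coord u l))\<^sup>2)"
      by (intro sum.cong) (auto simp: shift)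
    also have "\<dots> = (norm u)\<^sup>2" using R.norm_window[OF supp] by simp
    finally show ?thesis by simp
  qed
  finally have "norm (shifted z (v j)) < e * norm (v j)"
    by (rule power_less_imp_less_base) (use \<open>e > 0\<close> in auto)
  moreover have "{n. coord (v j) n \<noteq> 0} \<subseteq> {..nat (int (N j) + K)}"
    using v_supp[of j] by fastforce
  then have "finite {n. coord (v j) n \<noteq> 0}" by (rule finite_subset) simp
  moreover have "coord (v j) n = 0" if "n < N0" for n
  proof (rule ccontr)
    assume "coord (v j) n \<noteq> 0"
    then show False using v_supp[of j n] Nj that by linarith
  qed
  ultimately show "\<exists>u. finite {n. coord u n \<noteq> 0} \<and> (\<forall>n<N0. coord u n = 0) \<and> norm (shifted z u) < e * norm u"
    by blast
qed

text \<open>A vector that is good for \<open>w\<close> is also good for nearby \<open>z\<close>, as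
  the two images differ by at most \<open>cmod (w - z) * norm u\<close>.\<close>

lemma closed_weyl: "closed {z. weyl z}"
  unfolding closure_subset_eq[symmetric]
proof
  fix z assume z: "z \<in> closure {z. weyl z}"
  show "z \<in> {z. weyl z}"
    unfolding mem_Collect_eq weyl_def
  proof (intro allI impI)
    fix e :: real and N :: nat assume "e > 0"
    then obtain w where w: "weyl w" "dist w z < e / 2"
      using z unfolding closure_approachable by (metis half_gt_zero mem_Collect_eq)
    obtain u where u: "finite {n. coord u n \<noteq> 0}" "\<forall>n<N. coord u n = 0" "norm (shifted w u) < e / 2 * norm u"
      using w(1) \<open>e > 0\<close> unfolding weyl_def by (meson half_gt_zero)
    have "shifted z u = shifted w u + cscale (w - z) u"
      by (rule l2_eqI) (simp add: shifted_def algebra_simps)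
    then have "norm (shifted z u) \<le> norm (shifted w u) + cmod (w - z) * norm u"
      using norm_triangle_ineq[of "shifted w u" "cscale (w - z) u"] by simp
    also have "\<dots> < e / 2 * norm u + e / 2 * norm u"
      using u(3) w(2) by (intro add_less_le_mono mult_right_mono) (auto simp: dist_norm)
    finally show "\<exists>u. finite {n. coord u n \<noteq> 0} \<and> (\<forall>n<N. coord u n = 0) \<and> norm (shifted z u) < e * norm u"
      using u by (intro exI[of _ u]) (simp add: field_simps)
  qed
qed

end

subsection \<open>Localization and extraction of right limits\<close>

context half_line_jacobi
begin

text \<open>
  The commutator of \<open>J\<close> with the cutoff to \<open>{c..<c + L}\<close> lives at the two ends of the window, so summing
  over all \<open>c\<close> costs \<open>O(M\<^sup>2) * norm u\<^sup>2\<close>, whereas the cutoffs have total mass \<open>L * norm u\<^sup>2\<close>.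
\<close>

lemma sum_cutoff_le:
  fixes L :: nat and u :: "nat l2"
  assumes n: "n \<ge> 1" and C: "finite C"
  shows "(\<Sum>c\<in>C. (cmod (coord (shifted z (trunc {c..<c + L} u)) n))\<^sup>2) \<le>
    2 * L * (cmod (coord (shifted z u) n))\<^sup>2 + 8 * M\<^sup>2 * (cmod (coord u (Suc n)))\<^sup>2
    + 8 * M\<^sup>2 * (cmod (coord u (n - 1)))\<^sup>2"
proof -
  define I :: "nat \<Rightarrow> nat \<Rightarrow> real" where "I c n = of_bool (c \<le> n \<and> n < c + L)" for c n
  \<comment> \<open>\<open>D n c\<close> dominates the squared jump of the cutoff between
    \<open>n\<close> and \<open>Suc n\<close>: it registers the windows that begin at
    \<open>Suc n\<close> or end at \<open>n\<close>.\<close>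
  define D where "D n c = (of_bool (c = Suc n) + of_bool (c + L = Suc n) :: real)" for n c
  have D: "(I c (Suc n) - I c n)\<^sup>2 \<le> D n c" for c n
    by (auto simp: I_def D_def of_bool_def)
  let ?X = "\<lambda>c. a n * (I c (Suc n) - I c n) * coord u (Suc n)"
  let ?Y = "\<lambda>c. (if n \<ge> 2 then a (n - 1) else 0) * (I c (n - 1) - I c n) * coord u (n - 1)"
  \<comment> \<open>The diagonal commutes with the cutoff, so the commutator consists of the upper
    and lower neighbour terms \<open>?X\<close> and \<open>?Y\<close>.\<close>
  have split: "coord (shifted z (trunc {c..<c + L} u)) n = I c n * coord (shifted z u) n + (?X c + ?Y c)" for c
    unfolding coord_shifted[OF n] by (auto simp: coord_trunc I_def algebra_simps)
  have X: "(cmod (?X c))\<^sup>2 \<le> M\<^sup>2 * (cmod (coord u (Suc n)))\<^sup>2 * D n c" for c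
  proof -
    have "(a n)\<^sup>2 * (I c (Suc n) - I c n)\<^sup>2 \<le> M\<^sup>2 * D n c"
      using a_bound[OF n] D[of c n] by (intro mult_mono) (auto simp: abs_le_square_iff[symmetric])
    then have "(a n)\<^sup>2 * (I c (Suc n) - I c n)\<^sup>2 * (cmod (coord u (Suc n)))\<^sup>2 \<le> M\<^sup>2 * D n c * (cmod (coord u (Suc n)))\<^sup>2"
      by (rule mult_right_mono) simp
    moreover have "cmod (?X c) = \<bar>a n\<bar> * \<bar>I c (Suc n) - I c n\<bar> * cmod (coord u (Suc n))"
      by (simp only: norm_mult norm_of_real abs_mult)
    ultimately show ?thesis by (simp add: power_mult_distrib mult_ac)
  qed
  have Y: "(cmod (?Y c))\<^sup>2 \<le> M\<^sup>2 * (cmod (coord u (n - 1)))\<^sup>2 * D (n - 1) c" for c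
  proof (cases "n \<ge> 2")
    case True
    then have n1: "Suc (n - 1) = n" "n - 1 \<ge> 1" by auto
    have "(a (n - 1))\<^sup>2 * (I c (n - 1) - I c n)\<^sup>2 \<le> M\<^sup>2 * D (n - 1) c"
      using a_bound[OF n1(2)] D[of c "n - 1"] unfolding n1(1)
      by (intro mult_mono) (auto simp: abs_le_square_iff[symmetric] power2_commute)
    then have "(a (n - 1))\<^sup>2 * (I c (n - 1) - I c n)\<^sup>2 * (cmod (coord u (n - 1)))\<^sup>2 \<le> M\<^sup>2 * D (n - 1) c * (cmod (coord u (n - 1)))\<^sup>2"
      by (rule mult_right_mono) simp
    moreover have "cmod (?Y c) = \<bar>a (n - 1)\<bar> * \<bar>I c (n - 1) - I c n\<bar> * cmod (coord u (n - 1))"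
      using True by (simp only: norm_mult norm_of_real abs_mult if_True)
    ultimately show ?thesis by (simp add: power_mult_distrib mult_ac)
  qed (simp add: D_def)
  \<comment> \<open>Two uses of \<open>sq_add_le\<close> give the factors 2 and 4; since
    \<open>D\<close> sums to at most 2, the factor 4 ends up as 8.\<close>
  have pointwise: "(cmod (coord (shifted z (trunc {c..<c + L} u)) n))\<^sup>2 \<le>
      2 * (cmod (coord (shifted z u) n))\<^sup>2 * I c n + 4 * M\<^sup>2 * (cmod (coord u (Suc n)))\<^sup>2 * D n c
      + 4 * M\<^sup>2 * (cmod (coord u (n - 1)))\<^sup>2 * D (n - 1) c" for c
  proof -
    have "(cmod (coord (shifted z (trunc {c..<c + L} u)) n))\<^sup>2
        \<le> 2 * (cmod (I c n * coord (shifted z u) n))\<^sup>2 + 2 * (cmod (?X c + ?Y c))\<^sup>2"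
      unfolding split by (rule sq_add_le)
    also have "\<dots> \<le> 2 * (cmod (I c n * coord (shifted z u) n))\<^sup>2 + 2 * (2 * (cmod (?X c))\<^sup>2 + 2 * (cmod (?Y c))\<^sup>2)"
      by (intro add_mono mult_left_mono sq_add_le) auto
    also have "(cmod (I c n * coord (shifted z u) n))\<^sup>2 = (cmod (coord (shifted z u) n))\<^sup>2 * I c n"
      by (simp add: I_def)
    also have "2 * \<dots> + 2 * (2 * (cmod (?X c))\<^sup>2 + 2 * (cmod (?Y c))\<^sup>2) \<le>
        2 * ((cmod (coord (shifted z u) n))\<^sup>2 * I c n) +
        2 * (2 * (M\<^sup>2 * (cmod (coord u (Suc n)))\<^sup>2 * D n c) + 2 * (M\<^sup>2 * (cmod (coord u (n - 1)))\<^sup>2 * D (n - 1) c))"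
      by (intro add_mono mult_left_mono X Y order_refl) auto
    finally show ?thesis by (simp add: algebra_simps)
  qed
  have sum_I: "(\<Sum>c\<in>C. I c n) \<le> L"
  proof -
    have "{c \<in> C. c \<le> n \<and> n < c + L} \<subseteq> {Suc n - L..<Suc n}" by auto
    from card_mono[OF _ this] have "card {c \<in> C. c \<le> n \<and> n < c + L} \<le> L" by simp
    moreover have "(\<Sum>c\<in>C. I c n) = card {c \<in> C. c \<le> n \<and> n < c + L}"
      using C by (simp add: I_def sum_of_bool_eq Int_def)
    ultimately show ?thesis by simp
  qed
  have sum_D: "(\<Sum>c\<in>C. D n c) \<le> 2" for n
  proof -
    have "card {c \<in> C. c = Suc n} \<le> card {Suc n}" "card {c \<in> C. c + L = Suc n} \<le> card {Suc n - L}"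
      by (rule card_mono; auto)+
    moreover have "(\<Sum>c\<in>C. D n c) = real (card {c \<in> C. c = Suc n}) + card {c \<in> C. c + L = Suc n}"
      using C by (simp add: D_def sum.distrib sum_of_bool_eq Int_def)
    ultimately show ?thesis by simp
  qed
  have "(\<Sum>c\<in>C. (cmod (coord (shifted z (trunc {c..<c + L} u)) n))\<^sup>2) \<le>
      2 * (cmod (coord (shifted z u) n))\<^sup>2 * (\<Sum>c\<in>C. I c n)
      + 4 * M\<^sup>2 * (cmod (coord u (Suc n)))\<^sup>2 * (\<Sum>c\<in>C. D n c)
      + 4 * M\<^sup>2 * (cmod (coord u (n - 1)))\<^sup>2 * (\<Sum>c\<in>C. D (n - 1) c)"
    unfolding sum_distrib_left sum.distrib[symmetric] by (intro sum_mono pointwise)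
  also have "\<dots> \<le> 2 * (cmod (coord (shifted z u) n))\<^sup>2 * L
      + 4 * M\<^sup>2 * (cmod (coord u (Suc n)))\<^sup>2 * 2 + 4 * M\<^sup>2 * (cmod (coord u (n - 1)))\<^sup>2 * 2"
    by (intro add_mono mult_left_mono sum_I sum_D) auto
  finally show ?thesis by (simp add: mult_ac)
qed

text \<open>Every index of the support lies in exactly \<open>L\<close> windows; its distance from
  \<open>k0\<close> ensures that none of them is lost at the left end.\<close>

lemma sum_window_norms:
  fixes L :: nat and u :: "nat l2"
  assumes supp: "\<And>n. coord u n \<noteq> 0 \<Longrightarrow> k0 + L \<le> n \<and> n < Q"
  shows "(\<Sum>c\<in>{k0..<Q}. (norm (trunc {c..<c + L} u))\<^sup>2) = L * (norm u)\<^sup>2"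
proof -
  have "(norm (trunc {c..<c + L} u))\<^sup>2 = (\<Sum>n<Q. of_bool (c \<le> n \<and> n < c + L) * (cmod (coord u n))\<^sup>2)" for c
  proof -
    have "(norm (trunc {c..<c + L} u))\<^sup>2 = (\<Sum>n<Q. (cmod (coord (trunc {c..<c + L} u) n))\<^sup>2)"
      using supp by (intro norm_l2_sq_finite) (auto simp: coord_trunc)
    also have "\<dots> = (\<Sum>n<Q. of_bool (c \<le> n \<and> n < c + L) * (cmod (coord u n))\<^sup>2)"
      by (intro sum.cong) (auto simp: coord_trunc)
    finally show ?thesis .
  qed
  then have "(\<Sum>c\<in>{k0..<Q}. (norm (trunc {c..<c + L} u))\<^sup>2)
      = (\<Sum>c\<in>{k0..<Q}. \<Sum>n<Q. of_bool (c \<le> n \<and> n < c + L) * (cmod (coord u n))\<^sup>2)"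
    by simp
  also have "\<dots> = (\<Sum>n<Q. \<Sum>c\<in>{k0..<Q}. of_bool (c \<le> n \<and> n < c + L) * (cmod (coord u n))\<^sup>2)"
    by (rule sum.swap)
  also have "\<dots> = (\<Sum>n<Q. L * (cmod (coord u n))\<^sup>2)"
  proof (rule sum.cong)
    fix n assume "n \<in> {..<Q}"
    show "(\<Sum>c\<in>{k0..<Q}. of_bool (c \<le> n \<and> n < c + L) * (cmod (coord u n))\<^sup>2) = L * (cmod (coord u n))\<^sup>2"
    proof (cases "coord u n = 0")
      case False
      then have "{k0..<Q} \<inter> {c. c \<le> n \<and> n < c + L} = {Suc n - L..<Suc n}" "L \<le> Suc n"
        using supp[of n] by auto
      then show ?thesis
        by (simp add: sum_of_bool_eq flip: sum_distrib_right)
    qed simp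
  qed simp
  also have "\<dots> = L * (\<Sum>n<Q. (cmod (coord u n))\<^sup>2)"
    by (rule sum_distrib_left[symmetric])
  also have "(\<Sum>n<Q. (cmod (coord u n))\<^sup>2) = (norm u)\<^sup>2"
    by (rule norm_l2_sq_finite[symmetric]) (use supp in auto)
  finally show ?thesis .
qed

text \<open>Averaging over window positions: if no window achieved the ratio
  \<open>\<kappa>\<close>, summing the reverse inequalities would contradict the smallness for
  \<open>u\<close>.\<close>

lemma weyl_localized:
  fixes L :: nat
  assumes "weyl z" "L > 0" and \<kappa>: "16 * M\<^sup>2 / L < \<kappa>"
  obtains c :: nat and v :: "nat l2" where "c \<ge> k0" "\<And>n. coord v n \<noteq> 0 \<Longrightarrow> c \<le> n \<and> n < c + L"
    "norm v = 1" "(norm (shifted z v))\<^sup>2 < \<kappa>"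
proof -
  \<comment> \<open>Chosen so that \<open>2 * e\<^sup>2 + 16 * M\<^sup>2 / L\<close> is exactly
    \<open>\<kappa>\<close>; the second summand is the two boundary costs
    \<open>8 * M\<^sup>2\<close> divided by the total mass factor \<open>L\<close>.\<close>
  define e where "e = sqrt ((\<kappa> - 16 * M\<^sup>2 / L) / 2)"
  have "e\<^sup>2 = (\<kappa> - 16 * M\<^sup>2 / L) / 2"
    using \<kappa> unfolding e_def by (intro real_sqrt_pow2) simp
  then have e: "e > 0" "2 * e\<^sup>2 + 16 * M\<^sup>2 / L = \<kappa>"
    using \<kappa> by (auto simp: e_def field_simps)
  obtain u where u: "finite {n. coord u n \<noteq> 0}" "\<forall>n<k0 + L. coord u n = 0" "norm (shifted z u) < e * norm u"
    using assms(1) e(1) unfolding weyl_def by blast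
  obtain Q where "{n. coord u n \<noteq> 0} \<subseteq> {..<Q}"
    using u(1) finite_nat_iff_bounded by blast
  then have supp: "k0 + L \<le> n \<and> n < Q" if "coord u n \<noteq> 0" for n
    using that u(2) by (auto simp: not_less[symmetric])
  have u0: "coord u 0 = 0" using u(2) \<open>L > 0\<close> by simp
  define w where "w c = trunc {c..<c + L} u" for c
  have "\<exists>c\<ge>k0. (norm (shifted z (w c)))\<^sup>2 < \<kappa> * (norm (w c))\<^sup>2"
  proof (rule ccontr)
    assume "\<not> ?thesis"
    then have ge: "\<kappa> * (norm (w c))\<^sup>2 \<le> (norm (shifted z (w c)))\<^sup>2" if "c \<ge> k0" for c
      using that by (auto simp: not_less)
    have norm_w: "(norm (shifted z (w c)))\<^sup>2 = (\<Sum>n\<in>{1..Q}. (cmod (coord (shifted z (w c)) n))\<^sup>2)" for c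
    proof (rule norm_l2_sq_finite)
      fix n assume n: "n \<notin> {1..Q}"
      have zero: "coord (w c) m = 0" if "m \<ge> Q" for m
        using supp[of m] that by (auto simp: w_def coord_trunc)
      show "coord (shifted z (w c)) n = 0"
      proof (cases "n = 0")
        case True
        then show ?thesis by (simp add: coord_shifted_0 w_def coord_trunc u0)
      next
        case False
        then have "n \<ge> 1" "n - 1 \<ge> Q" using n by auto
        then show ?thesis by (simp add: coord_shifted zero)
      qed
    qed simp
    have "\<kappa> * (L * (norm u)\<^sup>2) = (\<Sum>c\<in>{k0..<Q}. \<kappa> * (norm (w c))\<^sup>2)"
      unfolding w_def sum_distrib_left[symmetric] by (subst sum_window_norms[OF supp]) auto
    also have "\<dots> \<le> (\<Sum>c\<in>{k0..<Q}. (norm (shifted z (w c)))\<^sup>2)"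
      by (intro sum_mono ge) simp
    also have "\<dots> = (\<Sum>n\<in>{1..Q}. \<Sum>c\<in>{k0..<Q}. (cmod (coord (shifted z (w c)) n))\<^sup>2)"
      unfolding norm_w by (rule sum.swap)
    also have "\<dots> \<le> (\<Sum>n\<in>{1..Q}. 2 * L * (cmod (coord (shifted z u) n))\<^sup>2
        + 8 * M\<^sup>2 * (cmod (coord u (Suc n)))\<^sup>2 + 8 * M\<^sup>2 * (cmod (coord u (n - 1)))\<^sup>2)"
      unfolding w_def by (intro sum_mono sum_cutoff_le) auto
    also have "\<dots> = 2 * L * (\<Sum>n\<in>{1..Q}. (cmod (coord (shifted z u) n))\<^sup>2)
        + 8 * M\<^sup>2 * (\<Sum>n\<in>{1..Q}. (cmod (coord u (Suc n)))\<^sup>2) + 8 * M\<^sup>2 * (\<Sum>n\<in>{1..Q}. (cmod (coord u (n - 1)))\<^sup>2)"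
      by (simp add: sum.distrib sum_distrib_left)
    also have "\<dots> \<le> 2 * L * (norm (shifted z u))\<^sup>2 + 8 * M\<^sup>2 * (norm u)\<^sup>2 + 8 * M\<^sup>2 * (norm u)\<^sup>2"
    proof (intro add_mono mult_left_mono)
      show "(\<Sum>n\<in>{1..Q}. (cmod (coord (shifted z u) n))\<^sup>2) \<le> (norm (shifted z u))\<^sup>2"
        by (rule sum_le_norm_l2_sq) simp
      have "(\<Sum>n\<in>{1..Q}. (cmod (coord u (Suc n)))\<^sup>2) = (\<Sum>m\<in>Suc ` {1..Q}. (cmod (coord u m))\<^sup>2)"
        by (subst sum.reindex) simp_all
      also have "\<dots> \<le> (norm u)\<^sup>2" by (rule sum_le_norm_l2_sq) simp
      finally show "(\<Sum>n\<in>{1..Q}. (cmod (coord u (Suc n)))\<^sup>2) \<le> (norm u)\<^sup>2" .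
      have "inj_on (\<lambda>n. n - 1) {1..Q}" by (auto simp: inj_on_def)
      then have "(\<Sum>n\<in>{1..Q}. (cmod (coord u (n - 1)))\<^sup>2) = (\<Sum>m\<in>(\<lambda>n. n - 1) ` {1..Q}. (cmod (coord u m))\<^sup>2)"
        by (simp add: sum.reindex)
      also have "\<dots> \<le> (norm u)\<^sup>2" by (rule sum_le_norm_l2_sq) simp
      finally show "(\<Sum>n\<in>{1..Q}. (cmod (coord u (n - 1)))\<^sup>2) \<le> (norm u)\<^sup>2" .
    qed auto
    also have "\<dots> < 2 * L * (e * norm u)\<^sup>2 + 8 * M\<^sup>2 * (norm u)\<^sup>2 + 8 * M\<^sup>2 * (norm u)\<^sup>2"
      using u(3) \<open>L > 0\<close> by (intro add_strict_right_mono mult_strict_left_mono power_strict_mono) auto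
    also have "\<dots> = (2 * e\<^sup>2 + 16 * M\<^sup>2 / L) * (L * (norm u)\<^sup>2)"
      using \<open>L > 0\<close> by (simp add: field_simps)
    finally show False unfolding e(2) by simp
  qed
  then obtain c where c: "c \<ge> k0" "(norm (shifted z (w c)))\<^sup>2 < \<kappa> * (norm (w c))\<^sup>2" by blast
  have w0: "norm (w c) > 0" using c(2) by (cases "w c = 0") auto
  show thesis
  proof (rule that[OF c(1)])
    show "c \<le> n \<and> n < c + L" if "coord (w c /\<^sub>R norm (w c)) n \<noteq> 0" for n
      using that by (auto simp: w_def coord_trunc split: if_splits)
    show "norm (w c /\<^sub>R norm (w c)) = 1" using w0 by simp
    show "(norm (shifted z (w c /\<^sub>R norm (w c))))\<^sup>2 < \<kappa>"
      using c(2) w0 by (simp add: shifted.scaleR power_mult_distrib power_divide field_simps)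
  qed
qed

lemma weyl_near_right_limit_spectrum:
  assumes "weyl z" and \<delta>: "\<delta> > 0"
  obtains ar br l where "(ar, br) \<in> right_limits a b" "l \<in> spectrum UNIV (jacobi UNIV ar br)"
    "cmod (l - z) \<le> 2 * \<delta>"
proof -
  define L where "L = nat \<lceil>16 * M\<^sup>2 / \<delta>\<^sup>2\<rceil> + 1"
  have "16 * M\<^sup>2 / \<delta>\<^sup>2 < L"
    unfolding L_def by linarith
  then have "16 * M\<^sup>2 < \<delta>\<^sup>2 * L"
    using \<delta> by (simp add: pos_divide_less_eq mult.commute)
  moreover have "L > 0" by (simp add: L_def)
  ultimately have L: "L > 0" "16 * M\<^sup>2 / L < \<delta>\<^sup>2"
    by (simp_all add: pos_divide_less_eq)
  define K where "K = int L + 1"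
  \<comment> \<open>The offset \<open>L + 4\<close> satisfies the window condition
    \<open>K + 2 \<le> int (c k)\<close>, and \<open>k\<close> drives the windows to
    infinity.\<close>
  have "\<exists>c v. c \<ge> L + 4 + k \<and> (\<forall>n. coord v n \<noteq> 0 \<longrightarrow> c \<le> n \<and> n < c + L) \<and> norm v = 1 \<and>
      (norm (shifted z v))\<^sup>2 < \<delta>\<^sup>2" for k
    using weyl_localized[OF assms(1) L, of "L + 4 + k"] by metis
  then obtain c v where c: "\<And>k. c k \<ge> L + 4 + k"
    and v: "\<And>k n. coord (v k) n \<noteq> 0 \<Longrightarrow> c k \<le> n \<and> n < c k + L" "\<And>k. norm (v k) = 1"
      "\<And>k. (norm (shifted z (v k)))\<^sup>2 < \<delta>\<^sup>2"
    by metis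
  have v_supp: "\<bar>int n - int (c k)\<bar> < K" if "coord (v k) n \<noteq> 0" for n k
    using v(1)[OF that] by (simp add: K_def)
  have c_ge: "K + 2 \<le> int (c k)" for k using c[of k] by (simp add: K_def)
  \<comment> \<open>For negative \<open>int (c k) + l\<close> the truncation reads the coefficients
    at 0, so these have to be bounded as well.\<close>
  define R where "R = max M (max \<bar>a 0\<bar> \<bar>b 0\<bar>)"
  have R: "\<bar>a n\<bar> \<le> R" "\<bar>b n\<bar> \<le> R" for n
    using a_bound[of n] b_bound[of n] by (cases "n \<ge> 1"; auto simp: R_def not_le)+
  \<comment> \<open>Coefficients and vector entries are bundled so that a single subsequence serves
    all three.\<close>
  define x where "x k l = (a (nat (int (c k) + l)), b (nat (int (c k) + l)), coord (v k) (nat (int (c k) + l)))" for k l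
  have "bounded (cball (0 :: real) R \<times> cball (0 :: real) R \<times> cball (0 :: complex) 1)"
    by (intro bounded_Times bounded_cball)
  moreover have "x k l \<in> cball 0 R \<times> cball 0 R \<times> cball 0 1" for k l
    using R cmod_coord_le[of "v k"] by (simp add: x_def v(2))
  ultimately obtain g r where r: "strict_mono r" and g: "\<And>l. (\<lambda>k. x (r k) l) \<longlonglongrightarrow> g l"
    using pointwise_convergent_subsequence[of _ x] by metis
  have "k \<le> c (r k)" for k
    using c[of "r k"] seq_suble[OF r, of k] by simp
  then obtain s :: "nat \<Rightarrow> nat" where s: "strict_mono s" "strict_mono (\<lambda>k. c (r (s k)))"
    using ex_strict_mono_subsequence[of "\<lambda>k. c (r k)"] by auto
  define N where "N k = c (r (s k))" for k
  define y where "y k = v (r (s k))" for k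
  define ar br h where "ar l = fst (g l)" and "br l = fst (snd (g l))" and "h l = snd (snd (g l))" for l
  have "(\<lambda>k. x (r (s k)) l) \<longlonglongrightarrow> g l" for l
    using LIMSEQ_subseq_LIMSEQ[OF g s(1), of l] by (simp add: o_def)
  from tendsto_fst[OF this] tendsto_fst[OF tendsto_snd[OF this]] tendsto_snd[OF tendsto_snd[OF this]]
  have lim: "(\<lambda>k. a (nat (int (N k) + l))) \<longlonglongrightarrow> ar l" "(\<lambda>k. b (nat (int (N k) + l))) \<longlonglongrightarrow> br l"
    "(\<lambda>k. coord (y k) (nat (int (N k) + l))) \<longlonglongrightarrow> h l" for l
    by (simp_all add: x_def N_def y_def ar_def br_def h_def)
  have "ar l \<ge> 0" for l
  proof (rule tendsto_lowerbound[OF lim(1)])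
    show "\<forall>\<^sub>F k in sequentially. 0 \<le> a (nat (int (N k) + l))"
    proof (rule eventually_sequentiallyI)
      fix k assume "k \<ge> nat \<bar>l\<bar> + 1"
      moreover have "N k \<ge> k" unfolding N_def by (rule seq_suble[OF s(2)])
      ultimately have "nat (int (N k) + l) \<ge> 1" by linarith
      then show "0 \<le> a (nat (int (N k) + l))" using a_pos less_imp_le by blast
    qed
  qed simp
  then have right_limit: "(ar, br) \<in> right_limits a b"
    using lim(1,2) s(2) unfolding right_limits_def N_def by blast
  interpret R: line_jacobi ar br M using right_limit by (rule right_limit_line_jacobi)
  have h_supp: "\<bar>l\<bar> < K" if "h l \<noteq> 0" for l
  proof (rule ccontr)
    assume l: "\<not> \<bar>l\<bar> < K"
    have "coord (y k) (nat (int (N k) + l)) = 0" for k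
    proof (rule ccontr)
      assume ne: "\<not> ?thesis"
      have "N k \<le> nat (int (N k) + l) \<and> nat (int (N k) + l) < N k + L"
        using v(1)[of "r (s k)" "nat (int (N k) + l)"] ne by (simp add: N_def y_def)
      with l c[of "r (s k)"] show False by (simp add: N_def K_def) linarith
    qed
    then have "h l = 0" using LIMSEQ_unique[OF lim(3)[of l]] by simp
    with that show False by simp
  qed
  have "h \<in> ell2 UNIV"
  proof (rule ell2_UNIV_I)
    fix F :: "int set" assume "finite F"
    have "(\<Sum>i\<in>F. (cmod (h i))\<^sup>2) = (\<Sum>i\<in>F \<inter> {- K..K}. (cmod (h i))\<^sup>2)"
      using \<open>finite F\<close> h_supp by (intro sum.mono_neutral_right) (auto, fastforce+)
    also have "\<dots> \<le> (\<Sum>i\<in>{- K..K}. (cmod (h i))\<^sup>2)" by (rule sum_mono2) auto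
    finally show "(\<Sum>i\<in>F. (cmod (h i))\<^sup>2) \<le> (\<Sum>i\<in>{- K..K}. (cmod (h i))\<^sup>2)" .
  qed
  then obtain w where w: "coord w = h" by (metis coord_inverse_ell2)
  have y_norm: "(norm (y k))\<^sup>2 = (\<Sum>l\<in>{- K..K}. (cmod (coord (y k) (nat (int (N k) + l))))\<^sup>2)" for k
    unfolding y_def N_def using v_supp[of "r (s k)"] c_ge[of "r (s k)"]
    by (intro norm_l2_sq_window) (auto intro: less_imp_le)
  \<comment> \<open>All mass sits in a window of fixed length, so none escapes in the entrywise
    limit and \<open>w\<close> stays a unit vector.\<close>
  have "(\<lambda>k. (norm (y k))\<^sup>2) \<longlonglongrightarrow> (norm w)\<^sup>2"
  proof -
    have "(norm w)\<^sup>2 = (\<Sum>l\<in>{- K..K}. (cmod (h l))\<^sup>2)"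
      unfolding w[symmetric] by (rule R.norm_window) (simp add: w h_supp)
    then show ?thesis
      unfolding y_norm by (auto intro!: tendsto_intros lim)
  qed
  moreover have "(norm (y k))\<^sup>2 = 1" for k by (simp add: y_def v(2))
  ultimately have "(norm w)\<^sup>2 = 1" by (simp add: LIMSEQ_const_iff)
  then have w1: "norm w = 1" using power2_eq_iff_nonneg[of "norm w" 1] by simp
  have "(norm (shifted z (y k)))\<^sup>2 = window_energy K z (\<lambda>l. a (nat (int (N k) + l)))
      (\<lambda>l. b (nat (int (N k) + l))) (\<lambda>l. coord (y k) (nat (int (N k) + l)))" for k
    unfolding y_def N_def by (rule norm_shifted_window[OF v_supp c_ge])
  moreover have "(norm (R.shifted z w))\<^sup>2 = window_energy K z ar br h"
    unfolding w[symmetric] by (rule R.norm_shifted_window) (simp add: w h_supp)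
  ultimately have "(\<lambda>k. (norm (shifted z (y k)))\<^sup>2) \<longlonglongrightarrow> (norm (R.shifted z w))\<^sup>2"
    by (simp add: tendsto_window_energy lim)
  moreover have "(norm (shifted z (y k)))\<^sup>2 \<le> \<delta>\<^sup>2" for k
    unfolding y_def by (rule less_imp_le) (rule v(3))
  ultimately have "(norm (R.shifted z w))\<^sup>2 \<le> \<delta>\<^sup>2"
    by (intro LIMSEQ_le_const2) auto
  then have "norm (R.shifted z w) \<le> \<delta>"
    by (rule power2_le_imp_le) (use \<delta> in simp)
  then have "norm (R.shifted z w) \<le> \<delta> * norm w"
    using w1 by simp
  moreover have "w \<noteq> 0" using w1 by auto
  ultimately obtain l where "cmod (l - z) \<le> 2 * \<delta>" "\<not> R.bounded_below l"
    using R.near_not_bounded_below by blast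
  with right_limit show thesis
    by (intro that[of ar br l]) (simp_all add: R.spectrum_iff)
qed

lemma closure_right_limit_spectra:
  "closure (\<Union>(ar, br)\<in>right_limits a b. spectrum UNIV (jacobi UNIV ar br)) =
    ess_spectrum {1..} (jacobi {1..} a b)"
proof -
  let ?U = "\<Union>(ar, br)\<in>right_limits a b. spectrum UNIV (jacobi UNIV ar br)"
  have "closure ?U \<subseteq> {z. weyl z}"
    using right_limit_spectrum_weyl by (intro closure_minimal closed_weyl) auto
  moreover have "z \<in> closure ?U" if "weyl z" for z
    unfolding closure_approachable
  proof (intro allI impI)
    fix e :: real assume "e > 0"
    \<comment> \<open>A third of \<open>e\<close> turns the bound \<open>2 * \<delta>\<close> into a
      strict inequality.\<close>
    then obtain ar br l where "(ar, br) \<in> right_limits a b" "l \<in> spectrum UNIV (jacobi UNIV ar br)"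
      "cmod (l - z) \<le> 2 * (e / 3)"
      using weyl_near_right_limit_spectrum[OF \<open>weyl z\<close>, of "e / 3"] by auto
    then show "\<exists>l\<in>?U. dist l z < e"
      using \<open>e > 0\<close> by (intro bexI[of _ l]) (auto simp: dist_norm)
  qed
  ultimately have "closure ?U = {z. weyl z}" by blast
  also have "\<dots> = ess_spectrum {1..} (jacobi {1..} a b)"
    using ess_spectrum_iff_weyl by blast
  finally show ?thesis .
qed

end

theorem theorem3p3:
  fixes a b :: "nat \<Rightarrow> real"
  assumes "\<And>n. n \<ge> 1 \<Longrightarrow> a n > 0"
    and "bdd_above ((\<lambda>n. \<bar>a n\<bar> + \<bar>b n\<bar>) ` {1..})"
  shows "closure (\<Union>(ar, br)\<in>right_limits a b. spectrum UNIV (jacobi UNIV ar br))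
         = ess_spectrum {1..} (jacobi {1..} a b)"
proof -
  obtain M where M: "\<And>n. n \<ge> 1 \<Longrightarrow> \<bar>a n\<bar> + \<bar>b n\<bar> \<le> M"
    using assms(2) by (auto simp: bdd_above_def)
  interpret half_line_jacobi a b M
  proof
    fix n :: nat assume n: "n \<ge> 1"
    show "a n > 0" using n by (rule assms(1))
    show "\<bar>a n\<bar> \<le> M" "\<bar>b n\<bar> \<le> M" using M[OF n] by auto
  qed
  show ?thesis by (rule closure_right_limit_spectra)
qed

end
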